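(* There exist absolute constants $c>0$ and $C_0>0$ (independent of all problem-related quantities) such that the following holds. Consider the linear model with endogeneity $y=\boldsymbol\beta^\top\boldsymbol x+\epsilon_1$, $\boldsymbol x=\boldsymbol\Theta^\top\boldsymbol z+\boldsymbol\epsilon_2$ described in the context, suppose that the instrument $\boldsymbol z$ satisfies the instrumental variable assumption and the regularity conditions (all listed in the context), and let $\hat{\boldsymbol\beta}_{\mathrm{2SLS}}$ be the two-stage least squares estimator computed from $n$ samples. Put $$K:=\frac{\lambda_{\min}(\boldsymbol\Sigma_z)}{6B_z^2},\qquad K_0:=\frac{\lambda_{\min}(\boldsymbol\Sigma_z)\,\sigma_{\min}^2(\boldsymbol\Theta)}{2B_{\epsilon_2}^2},\qquad \boldsymbol\Sigma_z:=\mathbb E[\boldsymbol z\boldsymbol z^\top].$$ If $$n\ge\max\left\{4c^2B_z^4\left(q+\log\left(\frac{4c^2B_z^4K}{q}\right)-\frac32\right),\ \frac{q e^{3/2}}{K},\ \frac{p^2(q+1)^2K}{qK_0^2}\right\},$$ then $$\mathbb E\left[\left\|\mathrm{clip}_{B_\beta}(\hat{\boldsymbol\beta}_{\mathrm{2SLS}})-\boldsymbol\beta\right\|^2\right]\le C_0\,\frac qn\left(\frac{B_\beta^2}{K}+C^2(n)\,\sigma_1^2\right),$$ where $$C(n):=\frac{\left(B_\Theta+\sqrt{\frac{2p(q+1)B_{\epsilon_2}^2\log\left(\frac Kq n\right)}{\lambda_{\min}(\boldsymbol\Sigma_z)n}}\right)B_z}{\lambda_{\min}(\boldsymbol\Sigma_z)\left(1-\frac{cB_z^2\left(\sqrt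 q+\sqrt{\log\left(\frac Kq n\right)-\frac12}\right)}{\sqrt n}\right)^2\left(\sigma_{\min}(\boldsymbol\Theta)-\sqrt{\frac{2p(q+1)B_{\epsilon_2}^2\log\left(\frac Kq n\right)}{\lambda_{\min}(\boldsymbol\Sigma_z)n}}\right)^2}.$$
   Context: Model: $y=\boldsymbol\beta^\top\boldsymbol x+\epsilon_1\in\mathbb R$ and $\boldsymbol x=\boldsymbol\Theta^\top\boldsymbol z+\boldsymbol\epsilon_2\in\mathbb R^p$, with instrument $\boldsymbol z\in\mathbb R^q$, true parameters $\boldsymbol\beta\in\mathbb R^p$, $\boldsymbol\Theta\in\mathbb R^{q\times p}$, centered random noise $\epsilon_1\in\mathbb R$ with variance $\sigma_1^2$ and centered random noise $\boldsymbol\epsilon_2\in\mathbb R^p$ with covariance matrix $\boldsymbol\Sigma_2$; $\boldsymbol\epsilon_2$ is unobserved and correlated with $\epsilon_1$ (so $\boldsymbol x$ may be correlated with $\epsilon_1$). Data: $(\boldsymbol z_i,\boldsymbol x_i,y_i)_{i=1}^n$ are i.i.d. samples from the model; $\boldsymbol Z\in\mathbb R^{n\times q}$, $\boldsymbol X\in\mathbb R^{n\times p}$, $\boldsymbol Y\in\mathbb R^n$ have rows $\boldsymbol z_i^\top$, $\boldsymbol x_i^\top$, $y_i$. Two-stage least squares estimator: $\hat{\boldsymbol\Theta}=(\boldsymbol Z^\top\boldsymbol Z)^{-1}\boldsymbol Z^\top\boldsymbol X$ and $\hat{\boldsymbol\beta}_{\mathrm{2SLS}}=(\hat{\boldsymbol\Theta}^\top\boldsymbol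 Z^\top\boldsymbol Z\hat{\boldsymbol\Theta})^{-1}\hat{\boldsymbol\Theta}^\top\boldsymbol Z^\top\boldsymbol Y$. Instrumental variable assumption: (i) $q\ge p$, and the data matrices $\boldsymbol Z,\boldsymbol X$ have full rank (this is taken to ensure that $\hat{\boldsymbol\beta}_{\mathrm{2SLS}}$ exists and is unique, i.e. the inverses above exist); (ii) $\mathrm{Corr}(\boldsymbol z,\boldsymbol x)\ne\boldsymbol 0$; (iii) $\mathrm{Corr}(\boldsymbol z,\epsilon_1)=0$. Regularity conditions: $\boldsymbol z$ is centered and (i) $\|\boldsymbol\beta\|\le B_\beta$, $\|\boldsymbol\Theta\|\le B_\Theta$; (ii) $\|\boldsymbol z\|\le B_z$, $\|\boldsymbol x\|\le B_x$, $|\epsilon_1|\le B_{\epsilon_1}$, $\|\boldsymbol\epsilon_2\|\le B_{\epsilon_2}$ (almost surely); (iii) $\mathbb E[x_k\mid\boldsymbol z]=\langle\boldsymbol\Theta_k,\boldsymbol z\rangle$ for each $k$, where $\boldsymbol\Theta_k$ is the $k$-th column of $\boldsymbol\Theta$. The quantities appearing in denominators, in particular $\lambda_{\min}(\boldsymbol\Sigma_z)$ and $\sigma_{\min}(\boldsymbol\Theta)$, are understood to be positive. Notation: $\|\cdot\|$ is the Euclidean norm of vectors and spectral norm of matrices; $\lambda_{\min}$ and $\sigma_{\min}$ are the smallest eigenvalue and smallest singular value. Clipping: $\mathrm{clip}_{B}(\boldsymbol v)=\boldsymbol v$ if $\|\boldsymbol v\|\le B$ and $\mathrm{clip}_B(\boldsymbol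 v)=\frac{B}{\|\boldsymbol v\|}\boldsymbol v$ if $\|\boldsymbol v\|>B$. *)

theory Defs
  imports
    "HOL-Probability.Probability"
    "Jordan_Normal_Form.Char_Poly"
    "Jordan_Normal_Form.Gauss_Jordan_Elimination"
    "Jordan_Normal_Form.DL_Rank"
begin

text \<open>Constants that do not depend on the dimensions are asserted to exist, so the dimensions
  must be ordinary variables: vectors and matrices are those of Jordan_Normal_Form, whose
  dimensions are natural numbers, not the type-indexed ones of HOL-Analysis.\<close>

unbundle no vec_syntax and no inner_syntax
hide_const (open) Finite_Cartesian_Product.vec Finite_Cartesian_Product.mat
  Finite_Cartesian_Product.row Finite_Cartesian_Product.rows Finite_Cartesian_Product.transpose


section \<open>Linear algebra\<close>

definition vnorm :: "real vec \<Rightarrow> real" where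
  "vnorm v = sqrt (v \<bullet> v)"

definition spectral_norm :: "real mat \<Rightarrow> real" where
  "spectral_norm A = Sup {vnorm (A *\<^sub>v v) |v. v \<in> carrier_vec (dim_col A) \<and> vnorm v \<le> 1}"

text \<open>To be used for symmetric matrices, all of whose eigenvalues are real.\<close>
definition lambda_min :: "real mat \<Rightarrow> real" where
  "lambda_min A = Min {k. eigenvalue A k}"

text \<open>To be used for matrices with at least as many rows as columns; these have as many singular
  values as columns, namely the square roots of the eigenvalues of the Gram matrix.\<close>
definition sigma_min :: "real mat \<Rightarrow> real" where
  "sigma_min A = Min {sqrt k |k. eigenvalue (transpose_mat A * A) k}"

definition full_rank :: "real mat \<Rightarrow> bool" where
  "full_rank A \<longleftrightarrow> vec_space.rank (dim_row A) A = min (dim_row A) (dim_col A)"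

text \<open>The inverse of a square matrix. The value at singular matrices is a dummy.\<close>
definition mat_inv :: "real mat \<Rightarrow> real mat" where
  "mat_inv A = (case mat_inverse A of Some B \<Rightarrow> B | None \<Rightarrow> 0\<^sub>m (dim_row A) (dim_col A))"

definition clip :: "real \<Rightarrow> real vec \<Rightarrow> real vec" where
  "clip B v = (if vnorm v \<le> B then v else (B / vnorm v) \<cdot>\<^sub>v v)"


section \<open>Second-order statistics\<close>

definition covariance :: "'a measure \<Rightarrow> ('a \<Rightarrow> real) \<Rightarrow> ('a \<Rightarrow> real) \<Rightarrow> real" where
  "covariance P f g =
     (LINT w|P. (f w - (LINT w|P. f w)) * (g w - (LINT w|P. g w)))"

text \<open>Zero if one of the two variables is almost surely constant.\<close>
definition correlation :: "'a measure \<Rightarrow> ('a \<Rightarrow> real) \<Rightarrow> ('a \<Rightarrow> real) \<Rightarrow> real" where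
  "correlation P f g = covariance P f g / sqrt (covariance P f f * covariance P g g)"

definition covariance_mat :: "nat \<Rightarrow> 'a measure \<Rightarrow> ('a \<Rightarrow> real vec) \<Rightarrow> real mat" where
  "covariance_mat d P v = mat d d (\<lambda>(i, j). covariance P (\<lambda>w. v w $ i) (\<lambda>w. v w $ j))"

definition correlation_mat ::
    "nat \<Rightarrow> nat \<Rightarrow> 'a measure \<Rightarrow> ('a \<Rightarrow> real vec) \<Rightarrow> ('a \<Rightarrow> real vec) \<Rightarrow> real mat" where
  "correlation_mat d e P u v =
     mat d e (\<lambda>(i, j). correlation P (\<lambda>w. u w $ i) (\<lambda>w. v w $ j))"

definition correlation_vec ::
    "nat \<Rightarrow> 'a measure \<Rightarrow> ('a \<Rightarrow> real vec) \<Rightarrow> ('a \<Rightarrow> real) \<Rightarrow> real vec" where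
  "correlation_vec d P u f = vec d (\<lambda>i. correlation P (\<lambda>w. u w $ i) f)"

definition second_moment_mat :: "nat \<Rightarrow> 'a measure \<Rightarrow> ('a \<Rightarrow> real vec) \<Rightarrow> real mat" where
  "second_moment_mat d P v = mat d d (\<lambda>(i, j). LINT w|P. v w $ i * v w $ j)"


section \<open>The model\<close>

text \<open>An observation consists of the instrument \<open>z\<close> and the noise terms \<open>\<epsilon>\<^sub>1\<close> and \<open>\<epsilon>\<^sub>2\<close>. The
  model is the joint law \<open>P\<close> of these three on the measurable space below, without any independence
  among them; \<open>x\<close> and \<open>y\<close> are then given by the structural equations. A sample of size \<open>n\<close> has the
  law \<open>PiM {..<n} (\<lambda>_. P)\<close>. Working with laws loses no generality, since every quantity of
  interest depends on the joint law only, and it keeps the absolute constants independent of the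
  type of an underlying probability space.\<close>

type_synonym obs = "(nat \<Rightarrow> real) \<times> real \<times> (nat \<Rightarrow> real)"

definition obs_space :: "nat \<Rightarrow> nat \<Rightarrow> obs measure" where
  "obs_space p q = PiM {..<q} (\<lambda>_. borel) \<Otimes>\<^sub>M (borel \<Otimes>\<^sub>M PiM {..<p} (\<lambda>_. borel))"

definition instrument :: "nat \<Rightarrow> obs \<Rightarrow> real vec" where
  "instrument q w = vec q (fst w)"

definition noise1 :: "obs \<Rightarrow> real" where
  "noise1 w = fst (snd w)"

definition noise2 :: "nat \<Rightarrow> obs \<Rightarrow> real vec" where
  "noise2 p w = vec p (snd (snd w))"

definition regressor :: "nat \<Rightarrow> nat \<Rightarrow> real mat \<Rightarrow> obs \<Rightarrow> real vec" where
  "regressor p q \<Theta> w = transpose_mat \<Theta> *\<^sub>v instrument q w + noise2 p w"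

definition response :: "nat \<Rightarrow> nat \<Rightarrow> real vec \<Rightarrow> real mat \<Rightarrow> obs \<Rightarrow> real" where
  "response p q \<beta> \<Theta> w = \<beta> \<bullet> regressor p q \<Theta> w + noise1 w"

definition sigma_z :: "nat \<Rightarrow> obs measure \<Rightarrow> real mat" where
  "sigma_z q P = second_moment_mat q P (instrument q)"

text \<open>Correlation between the two noise terms is permitted.\<close>
definition linear_model ::
    "nat \<Rightarrow> nat \<Rightarrow> real vec \<Rightarrow> real mat \<Rightarrow> real \<Rightarrow> real mat \<Rightarrow> obs measure \<Rightarrow> bool" where
  "linear_model p q \<beta> \<Theta> \<sigma>\<^sub>1 \<Sigma>\<^sub>2 P \<longleftrightarrow>
     prob_space P \<and> sets P = sets (obs_space p q) \<and>
     \<beta> \<in> carrier_vec p \<and> \<Theta> \<in> carrier_mat q p \<and>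
     integrable P noise1 \<and> (LINT w|P. noise1 w) = 0 \<and>
     integrable P (\<lambda>w. (noise1 w)\<^sup>2) \<and> 0 \<le> \<sigma>\<^sub>1 \<and> covariance P noise1 noise1 = \<sigma>\<^sub>1\<^sup>2 \<and>
     (\<forall>k<p. integrable P (\<lambda>w. noise2 p w $ k) \<and> (LINT w|P. noise2 p w $ k) = 0 \<and>
            integrable P (\<lambda>w. (noise2 p w $ k)\<^sup>2)) \<and>
     covariance_mat p P (noise2 p) = \<Sigma>\<^sub>2"

definition sample_law :: "nat \<Rightarrow> obs measure \<Rightarrow> (nat \<Rightarrow> obs) measure" where
  "sample_law n P = PiM {..<n} (\<lambda>_. P)"

definition data_Z :: "nat \<Rightarrow> nat \<Rightarrow> (nat \<Rightarrow> obs) \<Rightarrow> real mat" where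
  "data_Z n q \<omega> = mat_of_rows q (map (\<lambda>i. instrument q (\<omega> i)) [0..<n])"

definition data_X :: "nat \<Rightarrow> nat \<Rightarrow> nat \<Rightarrow> real mat \<Rightarrow> (nat \<Rightarrow> obs) \<Rightarrow> real mat" where
  "data_X n p q \<Theta> \<omega> = mat_of_rows p (map (\<lambda>i. regressor p q \<Theta> (\<omega> i)) [0..<n])"

definition data_Y :: "nat \<Rightarrow> nat \<Rightarrow> nat \<Rightarrow> real vec \<Rightarrow> real mat \<Rightarrow> (nat \<Rightarrow> obs) \<Rightarrow> real vec" where
  "data_Y n p q \<beta> \<Theta> \<omega> = vec n (\<lambda>i. response p q \<beta> \<Theta> (\<omega> i))"


section \<open>Two-stage least squares\<close>

definition theta_hat :: "real mat \<Rightarrow> real mat \<Rightarrow> real mat" where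
  "theta_hat Z X = mat_inv (transpose_mat Z * Z) * transpose_mat Z * X"

definition second_stage_gram :: "real mat \<Rightarrow> real mat \<Rightarrow> real mat" where
  "second_stage_gram Z X =
     transpose_mat (theta_hat Z X) * transpose_mat Z * Z * theta_hat Z X"

definition beta_2sls :: "real mat \<Rightarrow> real mat \<Rightarrow> real vec \<Rightarrow> real vec" where
  "beta_2sls Z X Y =
     (mat_inv (second_stage_gram Z X) * transpose_mat (theta_hat Z X) * transpose_mat Z) *\<^sub>v Y"

text \<open>Full rank of \<open>Z\<close> and \<open>X\<close> alone would not exclude a singular second-stage Gram matrix, so
  the existence of both inverses is stated explicitly.\<close>
definition iv_assumption :: "nat \<Rightarrow> nat \<Rightarrow> nat \<Rightarrow> real mat \<Rightarrow> obs measure \<Rightarrow> bool" where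
  "iv_assumption n p q \<Theta> P \<longleftrightarrow>
     p \<le> q \<and>
     (AE \<omega> in sample_law n P.
        let Z = data_Z n q \<omega>; X = data_X n p q \<Theta> \<omega> in
          full_rank Z \<and> full_rank X \<and>
          invertible_mat (transpose_mat Z * Z) \<and> invertible_mat (second_stage_gram Z X)) \<and>
     correlation_mat q p P (instrument q) (regressor p q \<Theta>) \<noteq> 0\<^sub>m q p \<and>
     correlation_vec q P (instrument q) noise1 = 0\<^sub>v q"

text \<open>The conditional expectation given \<open>z\<close> is the one with respect to the \<open>\<sigma>\<close>-algebra generated by
  the first component of an observation.\<close>
definition regularity ::
    "nat \<Rightarrow> nat \<Rightarrow> real vec \<Rightarrow> real mat \<Rightarrow> obs measure \<Rightarrow>
     real \<Rightarrow> real \<Rightarrow> real \<Rightarrow> real \<Rightarrow> real \<Rightarrow> real \<Rightarrow> bool" where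
  "regularity p q \<beta> \<Theta> P B\<beta> B\<Theta> Bz Bx B\<epsilon>\<^sub>1 B\<epsilon>\<^sub>2 \<longleftrightarrow>
     (\<forall>j<q. (LINT w|P. instrument q w $ j) = 0) \<and>
     vnorm \<beta> \<le> B\<beta> \<and> spectral_norm \<Theta> \<le> B\<Theta> \<and>
     (AE w in P. vnorm (instrument q w) \<le> Bz) \<and>
     (AE w in P. vnorm (regressor p q \<Theta> w) \<le> Bx) \<and>
     (AE w in P. \<bar>noise1 w\<bar> \<le> B\<epsilon>\<^sub>1) \<and>
     (AE w in P. vnorm (noise2 p w) \<le> B\<epsilon>\<^sub>2) \<and>
     (\<forall>k<p. AE w in P.
        real_cond_exp P (vimage_algebra (space P) fst (PiM {..<q} (\<lambda>_. borel)))
          (\<lambda>w. regressor p q \<Theta> w $ k) w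
        = col \<Theta> k \<bullet> instrument q w)"

end

theory Submission
  imports Defs
begin

text \<open>Choose \<open>U\<close> with \<open>U\<^sup>T \<Sigma>\<^sub>z U = I\<close> and put \<open>W = Z U\<close>. The rows of \<open>W\<close> have mean square norm \<open>q\<close>
  and squared norm at most \<open>B\<^sub>z\<^sup>2 / \<lambda>\<^sub>m\<^sub>i\<^sub>n = 1 / (6 K)\<close>, so second moments already give
  \<open>\<parallel>W\<^sup>T W / n - I\<parallel> \<le> 1 / 2\<close> outside an event of probability \<open>O(q / (K n))\<close>, the order of the first
  term of the bound; no matrix concentration is needed. Since \<open>E[z \<epsilon>\<^sub>2\<^sup>T] = 0\<close>, fourth moments of
  \<open>W\<^sup>T \<epsilon>\<^sub>2\<close> and the third condition on \<open>n\<close> give \<open>\<parallel>\<Theta>' - \<Theta>\<parallel> \<le> \<sigma>\<^sub>m\<^sub>i\<^sub>n(\<Theta>) / 2\<close> for the first-stage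
  estimate \<open>\<Theta>'\<close> up to a probability of the same order. Off these events the normal equations bound
  the error by \<open>4 \<parallel>Z\<^sup>T \<epsilon>\<^sub>1\<parallel> / (n \<lambda>\<^sub>m\<^sub>i\<^sub>n \<sigma>\<^sub>m\<^sub>i\<^sub>n(\<Theta>))\<close>, whose mean square is of order \<open>C(n)\<^sup>2 \<sigma>\<^sub>1\<^sup>2 / n\<close>; on them
  clipping bounds the loss by \<open>4 B\<^sub>\<beta>\<^sup>2\<close>. The constant \<open>c\<close> is arbitrary; \<open>c = 1\<close> is used.\<close>

section \<open>Euclidean norm and smallest eigenvalue\<close>

text \<open>Frobenius norms replace spectral norms because their means are sums of moments of
  coordinates. Whitening makes this affordable: a whitened row w has E|w|^2 = q and |w|^2 \<le> 1 /
  (6 K), hence E|w|^4 \<le> q / (6 K), which has the dimension only once. For the noise \<epsilon>2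
  a second moment would be too weak: Markov's inequality would give a probability of order q / (K0
  n), and K / K0 is not bounded by a constant. The fourth moment gives q^2 / (K0 n)^2, which the
  third condition turns into q / (K n). The logarithmic terms of C(n) never have to arise from the
  probabilistic part: each of them raises the numerator or lowers the denominator, so C(n) is at
  least Bz / (lam sig) once every subtracted term is smaller than what it is subtracted from. The
  conditions on n guarantee this strictly for the term in sigma_min - ..., but only weakly for the
  one in 1 - ..., so that equality has to be treated as a case of its own.\<close>

lemma scalar_prod_real_vec: "(v::real vec) \<bullet> w = (\<Sum>i<dim_vec w. v $ i * w $ i)"
  by (simp add: scalar_prod_def atLeast0LessThan)

lemma scalar_prod_self_nonneg: "0 \<le> (v::real vec) \<bullet> v"
  by (simp add: scalar_prod_real_vec sum_nonneg)

lemma vnorm_nonneg [simp]: "0 \<le> vnorm v"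
  by (simp add: vnorm_def scalar_prod_self_nonneg)

lemma vnorm_power2: "(vnorm v)\<^sup>2 = v \<bullet> v"
  by (simp add: vnorm_def scalar_prod_self_nonneg)

lemma vnorm_eq_0_iff: "v \<in> carrier_vec n \<Longrightarrow> vnorm v = 0 \<longleftrightarrow> v = 0\<^sub>v n"
proof -
  assume v: "v \<in> carrier_vec n"
  have "vnorm v = 0 \<longleftrightarrow> (\<Sum>i<n. (v $ i)\<^sup>2) = 0"
    using v by (simp add: vnorm_def scalar_prod_real_vec power2_eq_square)
  also have "\<dots> \<longleftrightarrow> (\<forall>i<n. v $ i = 0)"
    by (subst sum_nonneg_eq_0_iff) auto
  also have "\<dots> \<longleftrightarrow> v = 0\<^sub>v n"
    using v by auto
  finally show ?thesis .
qed

lemma vnorm_smult: "vnorm (c \<cdot>\<^sub>v v) = \<bar>c\<bar> * vnorm v"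
proof -
  have "(c \<cdot>\<^sub>v v) \<bullet> (c \<cdot>\<^sub>v v) = c\<^sup>2 * (v \<bullet> v)"
    by (simp add: scalar_prod_real_vec sum_distrib_left power2_eq_square mult_ac)
  then show ?thesis
    by (simp add: vnorm_def real_sqrt_mult)
qed

lemma scalar_prod_power2_le:
  fixes v w :: "real vec"
  assumes "v \<in> carrier_vec n" "w \<in> carrier_vec n"
  shows "(v \<bullet> w)\<^sup>2 \<le> (v \<bullet> v) * (w \<bullet> w)"
  using Cauchy_Schwarz_ineq_sum[of "\<lambda>i. v $ i" "\<lambda>i. w $ i" "{..<n}"] assms
  by (simp add: scalar_prod_real_vec power2_eq_square)

lemma scalar_prod_le_vnorm:
  assumes "v \<in> carrier_vec n" "w \<in> carrier_vec n"
  shows "v \<bullet> w \<le> vnorm v * vnorm w"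
  by (rule power2_le_imp_le)
    (use scalar_prod_power2_le[OF assms] in \<open>auto simp: power_mult_distrib vnorm_power2\<close>)

lemma vnorm_power2_minus:
  assumes "v \<in> carrier_vec n" "w \<in> carrier_vec n"
  shows "(vnorm (v - w))\<^sup>2 = (vnorm v)\<^sup>2 - 2 * (v \<bullet> w) + (vnorm w)\<^sup>2"
  using assms
  by (simp add: vnorm_power2 minus_scalar_prod_distrib[of _ n] scalar_prod_minus_distrib[of _ n]
      comm_scalar_prod[of w n v])

lemma vnorm_triangle:
  assumes "v \<in> carrier_vec n" "w \<in> carrier_vec n"
  shows "vnorm (v + w) \<le> vnorm v + vnorm w"
proof (rule power2_le_imp_le)
  have "(vnorm (v + w))\<^sup>2 = (vnorm v)\<^sup>2 + 2 * (v \<bullet> w) + (vnorm w)\<^sup>2"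
    using assms by (simp add: vnorm_power2 add_scalar_prod_distrib[of _ n]
        scalar_prod_add_distrib[of _ n] comm_scalar_prod[of w n v])
  then show "(vnorm (v + w))\<^sup>2 \<le> (vnorm v + vnorm w)\<^sup>2"
    using scalar_prod_le_vnorm[OF assms] by (simp add: power2_sum)
qed simp

lemma vnorm_triangle_minus:
  assumes "v \<in> carrier_vec n" "w \<in> carrier_vec n"
  shows "vnorm v - vnorm w \<le> vnorm (v + w)"
proof -
  have eq: "v = (v + w) + (- 1) \<cdot>\<^sub>v w"
    using assms by auto
  have "vnorm v \<le> vnorm (v + w) + vnorm ((- 1) \<cdot>\<^sub>v w)"
    by (subst eq) (rule vnorm_triangle[of _ n], use assms in auto)
  then show ?thesis
    by (simp add: vnorm_smult)
qed

lemma vnorm_minus_le: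
  assumes "v \<in> carrier_vec n" "w \<in> carrier_vec n"
  shows "vnorm (v - w) \<le> vnorm v + vnorm w"
proof -
  have eq: "v - w = v + (- 1) \<cdot>\<^sub>v w"
    using assms by auto
  have "vnorm (v + (- 1) \<cdot>\<^sub>v w) \<le> vnorm v + vnorm ((- 1) \<cdot>\<^sub>v w)"
    by (rule vnorm_triangle[of _ n], use assms in auto)
  then show ?thesis
    by (simp add: vnorm_smult eq)
qed

section \<open>Clipping as projection onto a ball\<close>

lemma clip_carrier: "v \<in> carrier_vec n \<Longrightarrow> clip B v \<in> carrier_vec n"
  by (simp add: clip_def)

lemma vnorm_clip_le: "0 \<le> B \<Longrightarrow> vnorm (clip B v) \<le> B"
  by (cases "vnorm v = 0") (auto simp: clip_def vnorm_smult abs_if)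

lemma clip_minus_le_bound:
  assumes "v \<in> carrier_vec n" "b \<in> carrier_vec n" "vnorm b \<le> B"
  shows "vnorm (clip B v - b) \<le> 2 * B"
proof -
  have "0 \<le> B" using assms(3) vnorm_nonneg[of b] by linarith
  then show ?thesis
    using vnorm_minus_le[OF clip_carrier[OF assms(1)] assms(2), of B] vnorm_clip_le[of B v] assms(3)
    by linarith
qed

text \<open>Clipping projects onto the ball of radius \<open>B\<close>, which contains
  \<open>b\<close>. With \<open>r = vnorm v > B\<close> the two squared distances differ by
  \<open>r\<^sup>2 - B\<^sup>2 - 2 * (1 - B / r) * (v \<bullet> b)\<close>, and
  \<open>v \<bullet> b \<le> r * B\<close> leaves at least \<open>(r - B)\<^sup>2\<close>.\<close>

lemma clip_minus_le:
  assumes v: "v \<in> carrier_vec n" and b: "b \<in> carrier_vec n" and B: "vnorm b \<le> B"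
  shows "vnorm (clip B v - b) \<le> vnorm (v - b)"
proof (cases "vnorm v \<le> B")
  case True
  then show ?thesis by (simp add: clip_def)
next
  case False
  define r where "r = vnorm v"
  have B0: "0 \<le> B" using B vnorm_nonneg[of b] by linarith
  have r: "r > B" "r > 0" using False B0 by (auto simp: r_def)
  have s: "v \<bullet> b \<le> r * B"
    using scalar_prod_le_vnorm[OF v b] mult_left_mono[OF B, of "vnorm v"]
    unfolding r_def by (meson vnorm_nonneg order_trans)
  have "(vnorm (clip B v - b))\<^sup>2 = B\<^sup>2 - 2 * (B / r) * (v \<bullet> b) + (vnorm b)\<^sup>2"
    using False v b r vnorm_power2_minus[of "(B / r) \<cdot>\<^sub>v v" n b]
    by (simp add: clip_def r_def[symmetric] vnorm_smult power_mult_distrib power_divide)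
  also have "\<dots> \<le> r\<^sup>2 - 2 * (v \<bullet> b) + (vnorm b)\<^sup>2"
  proof -
    have "2 * (1 - B / r) * (v \<bullet> b) \<le> 2 * (1 - B / r) * (r * B)"
      using r s by (intro mult_left_mono) (auto simp: field_simps)
    also have "\<dots> = 2 * (r - B) * B"
      using r by (simp add: field_simps)
    also have "\<dots> \<le> r\<^sup>2 - B\<^sup>2"
      using zero_le_power2[of "r - B"] by (simp add: power2_eq_square algebra_simps)
    finally show ?thesis by (simp add: algebra_simps)
  qed
  also have "\<dots> = (vnorm (v - b))\<^sup>2"
    using vnorm_power2_minus[OF v b] by (simp add: r_def)
  finally show ?thesis
    by (rule power2_le_imp_le) simp
qed

section \<open>Frobenius norm, semidefinite forms and the Rayleigh quotient\<close>

definition frobenius_sq :: "real mat \<Rightarrow> real" where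
  "frobenius_sq A = (\<Sum>i<dim_row A. \<Sum>j<dim_col A. (A $$ (i, j))\<^sup>2)"

lemma frobenius_sq_nonneg [simp]: "0 \<le> frobenius_sq A"
  by (simp add: frobenius_sq_def sum_nonneg)

text \<open>Cauchy-Schwarz, row by row. This is the only way in which operator bounds are obtained
  for random matrices below.\<close>

lemma vnorm_mult_mat_vec_le:
  assumes A: "A \<in> carrier_mat n m" and v: "v \<in> carrier_vec m"
  shows "(vnorm (A *\<^sub>v v))\<^sup>2 \<le> frobenius_sq A * (vnorm v)\<^sup>2"
proof -
  have "(vnorm (A *\<^sub>v v))\<^sup>2 = (\<Sum>i<n. (row A i \<bullet> v)\<^sup>2)"
    unfolding vnorm_power2 scalar_prod_real_vec[of _ "A *\<^sub>v v"] using A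
    by (simp add: power2_eq_square)
  also have "\<dots> \<le> (\<Sum>i<n. (row A i \<bullet> row A i) * (v \<bullet> v))"
    using A v by (intro sum_mono scalar_prod_power2_le[of _ m]) auto
  also have "\<dots> = frobenius_sq A * (vnorm v)\<^sup>2"
    unfolding vnorm_power2 using A
    by (simp add: frobenius_sq_def sum_distrib_right scalar_prod_real_vec power2_eq_square)
  finally show ?thesis .
qed

lemma smult_mult_mat_vec:
  assumes "(A :: 'a :: comm_ring_1 mat) \<in> carrier_mat n m" "v \<in> carrier_vec m"
  shows "A *\<^sub>v (k \<cdot>\<^sub>v v) = k \<cdot>\<^sub>v (A *\<^sub>v v)"
  using assms by (intro eq_vecI) auto

lemma smult_mat_mult_vec:
  assumes "(A :: 'a :: comm_ring_1 mat) \<in> carrier_mat n m" "v \<in> carrier_vec m"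
  shows "(k \<cdot>\<^sub>m A) *\<^sub>v v = k \<cdot>\<^sub>v (A *\<^sub>v v)"
  using assms by (intro eq_vecI) auto

lemma symmetric_scalar_prod:
  assumes A: "(A::real mat) \<in> carrier_mat n n" and sym: "transpose_mat A = A"
    and u: "u \<in> carrier_vec n" and v: "v \<in> carrier_vec n"
  shows "u \<bullet> (A *\<^sub>v v) = v \<bullet> (A *\<^sub>v u)"
  using transpose_vec_mult_scalar[OF A v u] A u v sym comm_scalar_prod[of "A *\<^sub>v u" n v] by simp

text \<open>The form is nonnegative along the line \<open>u + t \<cdot>\<^sub>v v\<close>, so its
  discriminant as a quadratic in \<open>t\<close> is not positive. As the form is only semidefinite,
  the coefficient of \<open>t\<^sup>2\<close> may vanish, which is a case of its own.\<close>

lemma psd_Cauchy_Schwarz: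
  assumes A: "(A::real mat) \<in> carrier_mat n n" and sym: "transpose_mat A = A"
    and psd: "\<And>v. v \<in> carrier_vec n \<Longrightarrow> 0 \<le> v \<bullet> (A *\<^sub>v v)"
    and u: "u \<in> carrier_vec n" and v: "v \<in> carrier_vec n"
  shows "(u \<bullet> (A *\<^sub>v v))\<^sup>2 \<le> (u \<bullet> (A *\<^sub>v u)) * (v \<bullet> (A *\<^sub>v v))"
proof -
  let ?a = "u \<bullet> (A *\<^sub>v u)" and ?b = "u \<bullet> (A *\<^sub>v v)" and ?c = "v \<bullet> (A *\<^sub>v v)"
  have q: "0 \<le> ?a + 2 * t * ?b + t\<^sup>2 * ?c" for t
  proof -
    let ?w = "u + t \<cdot>\<^sub>v v"
    have "?w \<bullet> (A *\<^sub>v ?w) = ?a + 2 * t * ?b + t\<^sup>2 * ?c"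
      using A u v symmetric_scalar_prod[OF A sym u v]
      by (simp add: mult_add_distrib_mat_vec[of _ n n] smult_mult_mat_vec[of _ n n]
          add_scalar_prod_distrib[of _ n] scalar_prod_add_distrib[of _ n] power2_eq_square
          algebra_simps)
    then show ?thesis using psd[of ?w] u v by simp
  qed
  show ?thesis
  proof (cases "?c = 0")
    case True
    have "?b = 0"
    proof (rule ccontr)
      assume b: "?b \<noteq> 0"
      \<comment> \<open>With vanishing \<open>?c\<close> the quadratic is affine, and at this
        \<open>t\<close> its value is \<open>-1\<close>.\<close>
      show False
        using q[of "- (?a + 1) / (2 * ?b)"] b True by (simp add: field_simps)
    qed
    then show ?thesis using True by simp
  next
    case False
    then have c: "?c > 0" using psd[OF v] by linarith
    have "0 \<le> ?c * (?a + 2 * (- ?b / ?c) * ?b + (- ?b / ?c)\<^sup>2 * ?c)"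
      using q[of "- ?b / ?c"] c by simp
    also have "\<dots> = ?a * ?c - ?b\<^sup>2"
      using c by (simp add: field_simps power2_eq_square)
    finally show ?thesis by simp
  qed
qed

text \<open>The infimum \<open>m\<close> of the Rayleigh quotient is an eigenvalue: otherwise \<open>A - m I\<close> would be
  invertible and positive semidefinite, hence coercive, and the infimum would exceed \<open>m\<close>.\<close>
lemma rayleigh_eigenvalue:
  assumes A: "(A::real mat) \<in> carrier_mat n n" and sym: "transpose_mat A = A" and n: "0 < n"
  obtains m where "eigenvalue A m"
    and "\<And>v. v \<in> carrier_vec n \<Longrightarrow> m * (vnorm v)\<^sup>2 \<le> v \<bullet> (A *\<^sub>v v)"
proof -
  define S where "S = {v \<bullet> (A *\<^sub>v v) |v. v \<in> carrier_vec n \<and> vnorm v = 1}"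
  define m where "m = Inf S"
  have ub: "\<bar>v \<bullet> (B *\<^sub>v v)\<bar> \<le> sqrt (frobenius_sq B) * (vnorm v)\<^sup>2"
    if "B \<in> carrier_mat n n" "v \<in> carrier_vec n" for B v
  proof (rule power2_le_imp_le)
    have "(v \<bullet> (B *\<^sub>v v))\<^sup>2 \<le> (vnorm v)\<^sup>2 * (vnorm (B *\<^sub>v v))\<^sup>2"
      using scalar_prod_power2_le[of v n "B *\<^sub>v v"] that by (simp add: vnorm_power2)
    also have "\<dots> \<le> (vnorm v)\<^sup>2 * (frobenius_sq B * (vnorm v)\<^sup>2)"
      by (intro mult_left_mono vnorm_mult_mat_vec_le[OF that]) simp
    finally show "\<bar>v \<bullet> (B *\<^sub>v v)\<bar>\<^sup>2 \<le> (sqrt (frobenius_sq B) * (vnorm v)\<^sup>2)\<^sup>2"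
      by (simp add: power_mult_distrib power2_eq_square mult_ac)
  qed (simp add: frobenius_sq_nonneg)
  have bdd: "bdd_below S"
  proof (rule bdd_belowI)
    fix x assume "x \<in> S"
    then obtain v where "v \<in> carrier_vec n" "vnorm v = 1" "x = v \<bullet> (A *\<^sub>v v)"
      by (auto simp: S_def)
    then show "- sqrt (frobenius_sq A) \<le> x"
      using ub[OF A, of v] by auto
  qed
  have "unit_vec n 0 \<bullet> (A *\<^sub>v unit_vec n 0) \<in> S"
    using n by (auto simp: S_def vnorm_def intro!: exI[of _ "unit_vec n 0"])
  then have ne: "S \<noteq> {}" by auto
  have ray: "m * (vnorm v)\<^sup>2 \<le> v \<bullet> (A *\<^sub>v v)" if v: "v \<in> carrier_vec n" for v
  proof (cases "vnorm v = 0")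
    case True
    then have "v = 0\<^sub>v n" using vnorm_eq_0_iff[OF v] by simp
    then show ?thesis using A True by simp
  next
    case False
    define u where "u = (1 / vnorm v) \<cdot>\<^sub>v v"
    have r: "vnorm v > 0" using False vnorm_nonneg[of v] by linarith
    have u: "u \<in> carrier_vec n" "vnorm u = 1"
      using v r by (auto simp: u_def vnorm_smult)
    have "u \<bullet> (A *\<^sub>v u) \<in> S" using u by (auto simp: S_def)
    then have "m \<le> u \<bullet> (A *\<^sub>v u)"
      unfolding m_def using bdd by (rule cInf_lower)
    also have "u \<bullet> (A *\<^sub>v u) = (v \<bullet> (A *\<^sub>v v)) / (vnorm v)\<^sup>2"
      using v A by (simp add: u_def smult_mult_mat_vec[of _ n n] power2_eq_square)
    finally show ?thesis using r by (simp add: field_simps)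
  qed
  have "eigenvalue A m"
  proof (rule ccontr)
    assume neg: "\<not> eigenvalue A m"
    define B where "B = char_matrix A m"
    have B: "B \<in> carrier_mat n n" using A by (simp add: B_def)
    have Bv: "B *\<^sub>v v = A *\<^sub>v v - m \<cdot>\<^sub>v v" if "v \<in> carrier_vec n" for v
      using A that unfolding B_def char_matrix_def
      by (intro eq_vecI) (auto simp: add_mult_distrib_mat_vec[of _ n n] smult_mat_mult_vec[of _ n n])
    have symB: "transpose_mat B = B"
    proof -
      have "A $$ (i, j) = A $$ (j, i)" if "i < n" "j < n" for i j
        using arg_cong[OF sym, of "\<lambda>M. M $$ (i, j)"] A that by simp
      then show ?thesis
        using A by (intro eq_matI) (auto simp: B_def char_matrix_def)
    qed
    have vBv: "v \<bullet> (B *\<^sub>v v) = v \<bullet> (A *\<^sub>v v) - m * (vnorm v)\<^sup>2" if "v \<in> carrier_vec n" for v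
      using A that by (simp add: Bv scalar_prod_minus_distrib[of _ n] vnorm_power2)
    have psd: "0 \<le> v \<bullet> (B *\<^sub>v v)" if "v \<in> carrier_vec n" for v
      using ray[OF that] vBv[OF that] by simp
    have "Determinant.det B \<noteq> 0"
      using neg eigenvalue_det[OF A] by (simp add: B_def)
    then obtain C where C: "C \<in> carrier_mat n n" "C * B = 1\<^sub>m n"
      using det_non_zero_imp_unit[OF B] by (auto simp: Units_def ring_mat_def)
    \<comment> \<open>The summand 1 keeps both constants positive, so that
      \<open>1 / (M * N)\<close> below is a genuine gap.\<close>
    define M where "M = frobenius_sq C + 1"
    define N where "N = sqrt (frobenius_sq B) + 1"
    have MN: "M > 0" "N > 0"
      using frobenius_sq_nonneg[of C] frobenius_sq_nonneg[of B] real_sqrt_ge_zero[of "frobenius_sq B"]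
      unfolding M_def N_def by linarith+
    \<comment> \<open>With \<open>w = B v\<close>, the semidefinite Cauchy-Schwarz inequality gives
      |w|^4 = (w \<bullet> B v)^2 \<le> (w \<bullet> B w) (v \<bullet> B v). Since w \<bullet> B w
      \<le> N |w|^2, it follows that |w|^2 \<le> N (v \<bullet> B v), and \<open>v = C w\<close>
      passes this on to \<open>v\<close>.\<close>
    have co: "(vnorm v)\<^sup>2 \<le> M * N * (v \<bullet> (B *\<^sub>v v))" if v: "v \<in> carrier_vec n" for v
    proof -
      let ?w = "B *\<^sub>v v"
      have w: "?w \<in> carrier_vec n" using B v by simp
      have "((vnorm ?w)\<^sup>2)\<^sup>2 \<le> (?w \<bullet> (B *\<^sub>v ?w)) * (v \<bullet> ?w)"
        using psd_Cauchy_Schwarz[OF B symB psd w v] by (simp add: vnorm_power2)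
      also have "\<dots> \<le> (N * (vnorm ?w)\<^sup>2) * (v \<bullet> ?w)"
      proof (rule mult_right_mono)
        show "?w \<bullet> (B *\<^sub>v ?w) \<le> N * (vnorm ?w)\<^sup>2"
          using abs_le_D1[OF ub[OF B w]] zero_le_power2[of "vnorm ?w"]
          unfolding N_def ring_distribs by linarith
        show "0 \<le> v \<bullet> ?w" by (rule psd[OF v])
      qed
      finally have "(vnorm ?w)\<^sup>2 * (vnorm ?w)\<^sup>2 \<le> (vnorm ?w)\<^sup>2 * (N * (v \<bullet> ?w))"
        by (simp add: power2_eq_square mult_ac)
      then have 1: "(vnorm ?w)\<^sup>2 \<le> N * (v \<bullet> ?w)"
        using MN psd[OF v] by (cases "vnorm ?w = 0") (auto simp del: power_add_numeral)
      have "C *\<^sub>v ?w = v"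
        using assoc_mult_mat_vec[OF C(1) B v] C(2) v by simp
      then have "(vnorm v)\<^sup>2 \<le> frobenius_sq C * (vnorm ?w)\<^sup>2"
        using vnorm_mult_mat_vec_le[OF C(1) w] by simp
      also have "\<dots> \<le> M * (vnorm ?w)\<^sup>2"
        by (intro mult_right_mono) (auto simp: M_def)
      also have "\<dots> \<le> M * (N * (v \<bullet> ?w))"
        using 1 MN by (intro mult_left_mono) auto
      finally show ?thesis by (simp add: mult_ac)
    qed
    have "m + 1 / (M * N) \<le> Inf S"
    proof (rule cInf_greatest[OF ne])
      fix x assume "x \<in> S"
      then obtain v where v: "v \<in> carrier_vec n" "vnorm v = 1" "x = v \<bullet> (A *\<^sub>v v)"
        by (auto simp: S_def)
      then have "1 \<le> M * N * (x - m)"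
        using co[OF v(1)] vBv[OF v(1)] by simp
      then show "m + 1 / (M * N) \<le> x"
        using MN by (simp add: field_simps)
    qed
    then show False using mult_pos_pos[OF MN] by (simp add: m_def)
  qed
  with ray show ?thesis using that by blast
qed

section \<open>Inequalities for the smallest eigenvalue, the smallest singular value and the
  spectral norm\<close>

lemma finite_eigenvalues:
  assumes "(A::real mat) \<in> carrier_mat n n"
  shows "finite {k. eigenvalue A k}"
proof -
  have "char_poly A \<noteq> 0" using degree_monic_char_poly[OF assms] by auto
  then show ?thesis
    using eigenvalue_root_char_poly[OF assms] poly_roots_finite[of "char_poly A"] by simp
qed

text \<open>The Rayleigh infimum is itself one of the finitely many eigenvalues, so their minimum
  lies below it. In dimension 0 there are no eigenvalues and \<open>lambda_min\<close> is an
  unspecified \<open>Min\<close>, but both sides vanish.\<close>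

lemma lambda_min_le:
  assumes A: "A \<in> carrier_mat n n" and sym: "transpose_mat A = A" and v: "v \<in> carrier_vec n"
  shows "lambda_min A * (vnorm v)\<^sup>2 \<le> v \<bullet> (A *\<^sub>v v)"
proof (cases "n = 0")
  case True
  then show ?thesis using v by (simp add: vnorm_def scalar_prod_real_vec)
next
  case False
  then obtain m where m: "eigenvalue A m"
    "\<And>v. v \<in> carrier_vec n \<Longrightarrow> m * (vnorm v)\<^sup>2 \<le> v \<bullet> (A *\<^sub>v v)"
    using rayleigh_eigenvalue[OF A sym] by blast
  have "lambda_min A \<le> m"
    unfolding lambda_min_def using finite_eigenvalues[OF A] m(1) by (intro Min_le) auto
  then show ?thesis
    using m(2)[OF v] mult_right_mono[of "lambda_min A" m "(vnorm v)\<^sup>2"] by simp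
qed

lemma sigma_min_le:
  assumes A: "A \<in> carrier_mat m n" and v: "v \<in> carrier_vec n" and pos: "0 < sigma_min A"
  shows "sigma_min A * vnorm v \<le> vnorm (A *\<^sub>v v)"
proof (cases "n = 0")
  case True
  then show ?thesis using v by (simp add: vnorm_def scalar_prod_real_vec sum_nonneg)
next
  case False
  let ?G = "transpose_mat A * A"
  have G: "?G \<in> carrier_mat n n" using A by auto
  have sym: "transpose_mat ?G = ?G"
    using A by (simp add: transpose_mult[of _ n m])
  obtain k where k: "eigenvalue ?G k"
    "\<And>v. v \<in> carrier_vec n \<Longrightarrow> k * (vnorm v)\<^sup>2 \<le> v \<bullet> (?G *\<^sub>v v)"
    using rayleigh_eigenvalue[OF G sym] False by blast
  have "{sqrt k |k. eigenvalue ?G k} = sqrt ` {k. eigenvalue ?G k}" by auto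
  then have "sigma_min A \<le> sqrt k"
    unfolding sigma_min_def using finite_eigenvalues[OF G] k(1) by (intro Min_le) auto
  then have s: "(sigma_min A)\<^sup>2 \<le> k"
  proof -
    \<comment> \<open>The real \<open>sqrt\<close> is odd, so a root need not come from a
      nonnegative number; a positive root certifies \<open>k > 0\<close> and can be squared
      back.\<close>
    have "0 < sqrt k" using pos \<open>sigma_min A \<le> sqrt k\<close> by linarith
    then have "k = (sqrt k)\<^sup>2" by simp
    then show ?thesis using pos \<open>sigma_min A \<le> sqrt k\<close> by (metis less_imp_le power_mono)
  qed
  have "v \<bullet> (?G *\<^sub>v v) = (vnorm (A *\<^sub>v v))\<^sup>2"
    using A v transpose_vec_mult_scalar[OF A v, of "A *\<^sub>v v"]
      comm_scalar_prod[of "transpose_mat A *\<^sub>v (A *\<^sub>v v)" n v]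
    by (simp add: vnorm_power2 assoc_mult_mat_vec[of _ n m _ n])
  then have "(sigma_min A * vnorm v)\<^sup>2 \<le> (vnorm (A *\<^sub>v v))\<^sup>2"
    using k(2)[OF v] mult_right_mono[OF s, of "(vnorm v)\<^sup>2"] by (simp add: power_mult_distrib)
  then show ?thesis by (rule power2_le_imp_le) simp
qed

lemma spectral_norm_ge:
  assumes A: "A \<in> carrier_mat m n" and v: "v \<in> carrier_vec n"
  shows "vnorm (A *\<^sub>v v) \<le> spectral_norm A * vnorm v"
proof (cases "vnorm v = 0")
  case True
  then have "v = 0\<^sub>v n" using vnorm_eq_0_iff[OF v] by simp
  then have "A *\<^sub>v v = 0\<^sub>v m" using A by auto
  then show ?thesis using True vnorm_eq_0_iff[of "0\<^sub>v m" m] by simp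
next
  case False
  let ?S = "{vnorm (A *\<^sub>v v) |v. v \<in> carrier_vec (dim_col A) \<and> vnorm v \<le> 1}"
  define u where "u = (1 / vnorm v) \<cdot>\<^sub>v v"
  have r: "vnorm v > 0" using False vnorm_nonneg[of v] by linarith
  have "vnorm (A *\<^sub>v u) \<le> Sup ?S"
  proof (rule cSup_upper)
    show "vnorm (A *\<^sub>v u) \<in> ?S"
      using v A r by (auto simp: u_def vnorm_smult intro!: exI[of _ "(1 / vnorm v) \<cdot>\<^sub>v v"])
    \<comment> \<open>The supremum in \<open>spectral_norm\<close> is meaningful only for a bounded
      set; the Frobenius norm supplies the bound.\<close>
    show "bdd_above ?S"
    proof (rule bdd_aboveI)
      fix x assume "x \<in> ?S"
      then obtain w where w: "w \<in> carrier_vec n" "vnorm w \<le> 1" "x = vnorm (A *\<^sub>v w)"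
        using A by auto
      have "x\<^sup>2 \<le> frobenius_sq A * (vnorm w)\<^sup>2"
        using vnorm_mult_mat_vec_le[OF A w(1)] w(3) by simp
      also have "\<dots> \<le> frobenius_sq A * 1"
        using w(2) by (intro mult_left_mono) (auto simp: power_le_one)
      finally show "x \<le> sqrt (frobenius_sq A)"
        by (simp add: real_le_rsqrt)
    qed
  qed
  moreover have "vnorm (A *\<^sub>v u) = vnorm (A *\<^sub>v v) / vnorm v"
    using v A r by (simp add: u_def smult_mult_mat_vec[of _ m n] vnorm_smult)
  ultimately show ?thesis
    using r by (simp add: spectral_norm_def field_simps)
qed

section \<open>Whitening and the second-stage error\<close>

text \<open>The new vector in the induction is any nonzero kernel vector of the matrix whose first \<open>k\<close> rows
  are the \<open>A u\<^sub>i\<close> and whose remaining rows vanish.\<close>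
lemma orthonormal_family:
  assumes A: "(A::real mat) \<in> carrier_mat n n" and sym: "transpose_mat A = A"
    and pd: "\<And>v. v \<in> carrier_vec n \<Longrightarrow> v \<noteq> 0\<^sub>v n \<Longrightarrow> 0 < v \<bullet> (A *\<^sub>v v)"
    and k: "k \<le> n"
  shows "\<exists>u. (\<forall>i<k. u i \<in> carrier_vec n) \<and>
             (\<forall>i<k. \<forall>j<k. u i \<bullet> (A *\<^sub>v u j) = (if i = j then 1 else 0))"
  using k
proof (induction k)
  case 0
  then show ?case by simp
next
  case (Suc k)
  then obtain u where u: "\<And>i. i < k \<Longrightarrow> u i \<in> carrier_vec n"
    "\<And>i j. i < k \<Longrightarrow> j < k \<Longrightarrow> u i \<bullet> (A *\<^sub>v u j) = (if i = j then 1 else 0)"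
    by auto
  define M where "M = mat n n (\<lambda>(i, j). if i < k then (A *\<^sub>v u i) $ j else 0)"
  have M: "M \<in> carrier_mat n n" by (simp add: M_def)
  \<comment> \<open>Row \<open>k\<close> of \<open>M\<close> is zero because \<open>k < n\<close>.
    Hence the transpose kills this unit vector, the determinant vanishes, and \<open>M\<close>
    itself has a nonzero kernel vector.\<close>
  have "transpose_mat M *\<^sub>v unit_vec n k = 0\<^sub>v n" "unit_vec n k \<noteq> (0\<^sub>v n :: real vec)"
  proof -
    show "transpose_mat M *\<^sub>v unit_vec n k = 0\<^sub>v n"
      using Suc.prems M by (intro eq_vecI) (auto simp: M_def scalar_prod_right_unit)
    have "unit_vec n k $ k = (1::real)" using Suc.prems by simp
    then show "unit_vec n k \<noteq> (0\<^sub>v n :: real vec)"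
      using Suc.prems by (metis Suc_le_lessD index_zero_vec(1) zero_neq_one)
  qed
  then have "Determinant.det (transpose_mat M) = 0"
    using det_0_iff_vec_prod_zero[of "transpose_mat M" n] M unit_vec_carrier[of n k] by fastforce
  then obtain v where v: "v \<in> carrier_vec n" "v \<noteq> 0\<^sub>v n" "M *\<^sub>v v = 0\<^sub>v n"
    using det_0_iff_vec_prod_zero[OF M] det_transpose[OF M] by auto
  have orth: "u i \<bullet> (A *\<^sub>v v) = 0" if "i < k" for i
  proof -
    have "row M i = A *\<^sub>v u i"
      using that Suc.prems A u(1)[OF that] by (intro eq_vecI) (auto simp: M_def)
    moreover have "row M i \<bullet> v = 0"
      using arg_cong[OF v(3), of "\<lambda>w. w $ i"] M that Suc.prems by simp
    ultimately have "(A *\<^sub>v u i) \<bullet> v = 0" by simp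
    then show ?thesis
      using transpose_vec_mult_scalar[OF A v(1) u(1)[OF that]] sym by simp
  qed
  define s where "s = v \<bullet> (A *\<^sub>v v)"
  have s: "s > 0" using pd[OF v(1,2)] by (simp add: s_def)
  define w where "w = (1 / sqrt s) \<cdot>\<^sub>v v"
  have w: "w \<in> carrier_vec n" using v by (simp add: w_def)
  have ww: "w \<bullet> (A *\<^sub>v w) = 1"
    using v A s by (simp add: w_def smult_mult_mat_vec[of _ n n] s_def[symmetric])
  have uw: "u i \<bullet> (A *\<^sub>v w) = 0" "w \<bullet> (A *\<^sub>v u i) = 0" if "i < k" for i
  proof -
    show "u i \<bullet> (A *\<^sub>v w) = 0"
      using v A u(1)[OF that] orth[OF that] by (simp add: w_def smult_mult_mat_vec[of _ n n])
    then show "w \<bullet> (A *\<^sub>v u i) = 0"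
      using symmetric_scalar_prod[OF A sym w u(1)[OF that]] by simp
  qed
  show ?case
    by (rule exI[of _ "u(k := w)"]) (use u w ww uw in \<open>auto simp: less_Suc_eq\<close>)
qed

text \<open>The columns of \<open>U\<close> are an \<open>A\<close>-orthonormal basis, so the
  entries of the product are the inner products
  \<open>col U i \<bullet> (A *\<^sub>v col U j)\<close>. Nothing makes this \<open>U\<close>
  symmetric.\<close>

lemma whitening_matrix:
  assumes A: "(A::real mat) \<in> carrier_mat n n" and sym: "transpose_mat A = A"
    and pd: "\<And>v. v \<in> carrier_vec n \<Longrightarrow> v \<noteq> 0\<^sub>v n \<Longrightarrow> 0 < v \<bullet> (A *\<^sub>v v)"
  obtains U where "U \<in> carrier_mat n n" "transpose_mat U * A * U = 1\<^sub>m n"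
proof -
  obtain u where u: "\<And>i. i < n \<Longrightarrow> u i \<in> carrier_vec n"
    "\<And>i j. i < n \<Longrightarrow> j < n \<Longrightarrow> u i \<bullet> (A *\<^sub>v u j) = (if i = j then 1 else 0)"
    using orthonormal_family[OF A sym pd, of n] by auto
  define U where "U = mat_of_cols n (map u [0..<n])"
  have U: "U \<in> carrier_mat n n" by (simp add: U_def mat_of_cols_def)
  have col: "col U i = u i" if "i < n" for i
    using that u(1) by (simp add: U_def)
  have "transpose_mat U * A * U = transpose_mat U * (A * U)"
    using U A by (intro assoc_mult_mat[of _ n n _ n _ n]) auto
  moreover have "transpose_mat U * (A * U) = 1\<^sub>m n"
  proof (rule eq_matI)
    fix i j assume ij: "i < dim_row (1\<^sub>m n :: real mat)" "j < dim_col (1\<^sub>m n :: real mat)"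
    then have "(transpose_mat U * (A * U)) $$ (i, j) = col U i \<bullet> (A *\<^sub>v col U j)"
      using U A by (simp add: col_mult2[of _ n n _ n] mult_mat_vec_def)
    then show "(transpose_mat U * (A * U)) $$ (i, j) = 1\<^sub>m n $$ (i, j)"
      using ij u(2)[of i j] col by simp
  qed (use U A in auto)
  ultimately show ?thesis using that U by simp
qed

text \<open>|v|^2 = (U v) \<bullet> A (U v) \<ge> l |U v|^2 gives the first bound, and duality
  carries it over to the transpose. Both are used: the transpose acts on the instruments, while
  \<open>U\<close> itself returns from whitened coordinates to the original ones.\<close>

lemma whitening_vnorm_le:
  assumes A: "(A::real mat) \<in> carrier_mat n n" and U: "U \<in> carrier_mat n n"
    and UAU: "transpose_mat U * A * U = 1\<^sub>m n" and l: "0 < l"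
    and low: "\<And>v. v \<in> carrier_vec n \<Longrightarrow> l * (vnorm v)\<^sup>2 \<le> v \<bullet> (A *\<^sub>v v)"
    and v: "v \<in> carrier_vec n"
  shows "vnorm (U *\<^sub>v v) \<le> vnorm v / sqrt l"
    and "vnorm (transpose_mat U *\<^sub>v v) \<le> vnorm v / sqrt l"
proof -
  have *: "vnorm (U *\<^sub>v v) \<le> vnorm v / sqrt l" if v: "v \<in> carrier_vec n" for v
  proof -
    have "v = (transpose_mat U * A * U) *\<^sub>v v" using UAU v by simp
    also have "\<dots> = transpose_mat U *\<^sub>v (A *\<^sub>v (U *\<^sub>v v))"
      using U A v by (simp add: assoc_mult_mat_vec[of _ n n _ n])
    finally have "v \<bullet> v = (U *\<^sub>v v) \<bullet> (A *\<^sub>v (U *\<^sub>v v))"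
      using transpose_vec_mult_scalar[OF U v, of "A *\<^sub>v (U *\<^sub>v v)"] U A v
        comm_scalar_prod[of "A *\<^sub>v (U *\<^sub>v v)" n "U *\<^sub>v v"] by simp
    then have "l * (vnorm (U *\<^sub>v v))\<^sup>2 \<le> (vnorm v)\<^sup>2"
      using low[of "U *\<^sub>v v"] U v by (simp add: vnorm_power2)
    then have "(vnorm (U *\<^sub>v v))\<^sup>2 \<le> (vnorm v / sqrt l)\<^sup>2"
      using l by (simp add: power_divide field_simps)
    then show ?thesis by (rule power2_le_imp_le) (use l in simp)
  qed
  from *[OF v] show "vnorm (U *\<^sub>v v) \<le> vnorm v / sqrt l" .
  let ?w = "transpose_mat U *\<^sub>v v"
  have w: "?w \<in> carrier_vec n" using U v by simp
  have "?w \<bullet> ?w = v \<bullet> (U *\<^sub>v ?w)"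
    by (rule transpose_vec_mult_scalar[OF U w v])
  also have "\<dots> \<le> vnorm v * vnorm (U *\<^sub>v ?w)"
    using U w v by (intro scalar_prod_le_vnorm[of _ n]) auto
  also have "\<dots> \<le> vnorm v * (vnorm ?w / sqrt l)"
    using *[OF w] by (intro mult_left_mono) auto
  finally have "vnorm ?w * vnorm ?w \<le> vnorm ?w * (vnorm v / sqrt l)"
    by (simp add: vnorm_power2[symmetric] power2_eq_square mult_ac)
  then show "vnorm ?w \<le> vnorm v / sqrt l"
    using vnorm_nonneg[of ?w] vnorm_nonneg[of v] l
    by (cases "vnorm ?w = 0") (auto simp: mult_le_cancel_left simp del: times_divide_eq_right)
qed

section \<open>Deterministic bound on the error of the two-stage estimator\<close>

lemma mat_inv_invertible:
  assumes A: "A \<in> carrier_mat n n" and inv: "invertible_mat A"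
  shows "mat_inv A \<in> carrier_mat n n" "A * mat_inv A = 1\<^sub>m n" "mat_inv A * A = 1\<^sub>m n"
proof -
  obtain B where AB: "A * B = 1\<^sub>m n" and BA: "B * A = 1\<^sub>m (dim_row B)"
    using inv A unfolding invertible_mat_def inverts_mat_def by auto
  \<comment> \<open>\<open>invertible_mat\<close> does not state the shape of \<open>B\<close>;
    comparing the numbers of columns in both identities determines it.\<close>
  have "dim_col B = n" using arg_cong[OF AB, of dim_col] by simp
  moreover have "dim_row B = n" using arg_cong[OF BA, of dim_col] A by simp
  ultimately have B: "B \<in> carrier_mat n n" by auto
  have "A \<in> Units (ring_mat TYPE(real) n b)" for b
    using A B AB BA by (auto simp: Units_def ring_mat_def)
  then obtain C where C: "mat_inverse A = Some C"
    using mat_inverse(1)[OF A] by (metis option.exhaust)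
  then show "mat_inv A \<in> carrier_mat n n" "A * mat_inv A = 1\<^sub>m n" "mat_inv A * A = 1\<^sub>m n"
    using mat_inverse(2)[OF A C] by (auto simp: mat_inv_def)
qed

lemma vec_add_minus_cancel:
  fixes x y :: "'a :: ab_group_add vec"
  assumes "x \<in> carrier_vec n" "y \<in> carrier_vec n"
  shows "x + y - x = y" "x - y + y = x" "x + (y - x) = y"
  using assms by (auto intro!: eq_vecI)

text \<open>Let T be the first-stage estimate and \<delta> the error. As Z^T Z T = Z^T X, the
  first-stage residual drops out of the second-stage normal equations, and |Z T \<delta>|^2 = (Z^T
  e) \<bullet> (T \<delta>). Hypothesis \<open>D\<close> gives |Z a|^2 \<ge> (n l / 2) |a|^2, and
  \<open>M\<close> gives |T v| \<ge> (s / 2) |v|; the two halves make up the factor 4.\<close>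

lemma second_stage_error_bound:
  fixes Z X E \<Theta> U :: "real mat" and \<beta> e :: "real vec"
  assumes carr: "Z \<in> carrier_mat n q" "E \<in> carrier_mat n p" "\<Theta> \<in> carrier_mat q p"
      "\<beta> \<in> carrier_vec p" "e \<in> carrier_vec n" "U \<in> carrier_mat q q" "V \<in> carrier_mat q q"
    and X: "X = Z * \<Theta> + E" and Y: "Y = X *\<^sub>v \<beta> + e"
    and n: "0 < n" and l: "0 < l" and s: "0 < s"
    and UV: "U * V = 1\<^sub>m q"
    and U: "\<And>v. v \<in> carrier_vec q \<Longrightarrow> vnorm (U *\<^sub>v v) \<le> vnorm v / sqrt l"
    and \<Theta>: "\<And>v. v \<in> carrier_vec p \<Longrightarrow> s * vnorm v \<le> vnorm (\<Theta> *\<^sub>v v)"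
    and inv1: "invertible_mat (transpose_mat Z * Z)"
    and inv2: "invertible_mat (second_stage_gram Z X)"
    and D: "frobenius_sq (transpose_mat (Z * U) * (Z * U) - real n \<cdot>\<^sub>m 1\<^sub>m q) \<le> (real n / 2)\<^sup>2"
    and M: "frobenius_sq (transpose_mat (Z * U) * E) \<le> (real n * sqrt l * s / 4)\<^sup>2"
  shows "vnorm (beta_2sls Z X Y - \<beta>) \<le> 4 * vnorm (transpose_mat Z *\<^sub>v e) / (real n * l * s)"
proof -
  let ?W = "Z * U" and ?G = "transpose_mat Z * Z" and ?T = "theta_hat Z X"
  let ?D = "transpose_mat ?W * ?W - real n \<cdot>\<^sub>m 1\<^sub>m q" and ?M = "transpose_mat ?W * E"
  note [simp] = carr
  have Xc [simp]: "X \<in> carrier_mat n p" by (simp add: X)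
  have Yc [simp]: "Y \<in> carrier_vec n" unfolding Y
    by (rule add_carrier_vec[OF mult_mat_vec_carrier[OF Xc carr(4)] carr(5)])
  have tc [simp]: "transpose_mat Z \<in> carrier_mat q n" by simp
  have G: "?G \<in> carrier_mat q q" by (rule mult_carrier_mat[OF tc]) simp
  note Gi = mat_inv_invertible[OF G inv1]
  have T [simp]: "?T \<in> carrier_mat q p"
    unfolding theta_hat_def
    by (rule mult_carrier_mat[OF mult_carrier_mat[OF Gi(1) tc] Xc])
  have tT [simp]: "transpose_mat ?T \<in> carrier_mat p q" by simp
  have W [simp]: "?W \<in> carrier_mat n q" by (rule mult_carrier_mat[OF carr(1,6)])
  have tW: "transpose_mat ?W *\<^sub>v y = transpose_mat U *\<^sub>v (transpose_mat Z *\<^sub>v y)"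
    if "y \<in> carrier_vec n" for y
    unfolding transpose_mult[OF carr(1,6)] 
    by (rule assoc_mult_mat_vec[OF transpose_carrier_mat[THEN iffD2, OF carr(6)] tc that])
  have tWc [simp]: "transpose_mat ?W \<in> carrier_mat q n" by simp
  have WtW [simp]: "transpose_mat ?W * ?W \<in> carrier_mat q q" by (rule mult_carrier_mat[OF tWc W])
  have Dc [simp]: "?D \<in> carrier_mat q q" by auto
  have Mc [simp]: "?M \<in> carrier_mat q p" by (rule mult_carrier_mat[OF tWc carr(2)])
  \<comment> \<open>The normal equations of the first stage, applied to a vector.\<close>
  have normal1: "transpose_mat Z *\<^sub>v (Z *\<^sub>v (?T *\<^sub>v v)) = transpose_mat Z *\<^sub>v (X *\<^sub>v v)"
    if v: "v \<in> carrier_vec p" for v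
  proof -
    have x: "X *\<^sub>v v \<in> carrier_vec n" using mult_mat_vec_carrier[OF Xc v] .
    have zx: "transpose_mat Z *\<^sub>v (X *\<^sub>v v) \<in> carrier_vec q" using mult_mat_vec_carrier[OF tc x] .
    have "mat_inv ?G * transpose_mat Z \<in> carrier_mat q n"
      using Gi(1) tc by (rule mult_carrier_mat)
    then have Tv: "?T *\<^sub>v v = mat_inv ?G *\<^sub>v (transpose_mat Z *\<^sub>v (X *\<^sub>v v))"
      unfolding theta_hat_def
      by (simp only: assoc_mult_mat_vec[OF _ Xc v] assoc_mult_mat_vec[OF Gi(1) tc x])
    have "?T *\<^sub>v v \<in> carrier_vec q" using mult_mat_vec_carrier[OF T v] .
    then have "transpose_mat Z *\<^sub>v (Z *\<^sub>v (?T *\<^sub>v v)) = ?G *\<^sub>v (?T *\<^sub>v v)"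
      by (simp only: assoc_mult_mat_vec[OF tc carr(1)])
    also have "\<dots> = (?G * mat_inv ?G) *\<^sub>v (transpose_mat Z *\<^sub>v (X *\<^sub>v v))"
      unfolding Tv by (rule assoc_mult_mat_vec[OF G Gi(1) zx, symmetric])
    finally show ?thesis using Gi(2) zx by simp
  qed
  have WW: "transpose_mat ?W *\<^sub>v (?W *\<^sub>v g) = ?D *\<^sub>v g + real n \<cdot>\<^sub>v g"
    if g: "g \<in> carrier_vec q" for g
  proof -
    have "?D *\<^sub>v g = (transpose_mat ?W * ?W) *\<^sub>v g - (real n \<cdot>\<^sub>m 1\<^sub>m q) *\<^sub>v g"
      by (rule minus_mult_distrib_mat_vec[OF WtW _ g]) simp
    also have "(real n \<cdot>\<^sub>m 1\<^sub>m q) *\<^sub>v g = real n \<cdot>\<^sub>v g"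
      using g by (simp add: smult_mat_mult_vec[of _ q q])
    also have "(transpose_mat ?W * ?W) *\<^sub>v g = transpose_mat ?W *\<^sub>v (?W *\<^sub>v g)"
      by (rule assoc_mult_mat_vec[OF tWc W g])
    finally have "?D *\<^sub>v g = transpose_mat ?W *\<^sub>v (?W *\<^sub>v g) - real n \<cdot>\<^sub>v g" .
    then show ?thesis
      using vec_add_minus_cancel(2)[OF mult_mat_vec_carrier[OF tWc mult_mat_vec_carrier[OF W g]]
          smult_carrier_vec[THEN iffD2, OF g]] by (simp only:)
  qed
  have Dg: "vnorm (?D *\<^sub>v g) \<le> real n / 2 * vnorm g" if g: "g \<in> carrier_vec q" for g
  proof (rule power2_le_imp_le)
    have "(vnorm (?D *\<^sub>v g))\<^sup>2 \<le> frobenius_sq ?D * (vnorm g)\<^sup>2"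
      by (rule vnorm_mult_mat_vec_le[OF Dc g])
    also have "\<dots> \<le> (real n / 2)\<^sup>2 * (vnorm g)\<^sup>2"
      by (intro mult_right_mono D) simp
    finally show "(vnorm (?D *\<^sub>v g))\<^sup>2 \<le> (real n / 2 * vnorm g)\<^sup>2"
      by (simp only: power_mult_distrib)
  qed simp
  have UVa: "U *\<^sub>v (V *\<^sub>v a) = a" if "a \<in> carrier_vec q" for a
    using assoc_mult_mat_vec[OF carr(6,7) that, symmetric] UV that by simp
  have Za: "Z *\<^sub>v a = ?W *\<^sub>v (V *\<^sub>v a)" if a: "a \<in> carrier_vec q" for a
    using assoc_mult_mat_vec[OF carr(1,6) mult_mat_vec_carrier[OF carr(7) a]] UVa[OF a] by simp
  \<comment> \<open>The bound on \<open>U\<close>, read backwards for its inverse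
    \<open>V\<close>.\<close>
  have Va: "sqrt l * vnorm a \<le> vnorm (V *\<^sub>v a)" if a: "a \<in> carrier_vec q" for a
    using U[OF mult_mat_vec_carrier[OF carr(7) a]] l UVa[OF a] by (simp add: field_simps)
  \<comment> \<open>In the whitened coordinate \<open>g = V a\<close> the Gram matrix is
    \<open>n I + ?D\<close>, and the perturbation costs at most half of \<open>n\<close>.\<close>
  have lowZ: "real n / 2 * l * (vnorm a)\<^sup>2 \<le> (vnorm (Z *\<^sub>v a))\<^sup>2" if a: "a \<in> carrier_vec q" for a
  proof -
    define g where "g = V *\<^sub>v a"
    have g: "g \<in> carrier_vec q" unfolding g_def by (rule mult_mat_vec_carrier[OF carr(7) a])
    have "(vnorm (Z *\<^sub>v a))\<^sup>2 = (?W *\<^sub>v g) \<bullet> (?W *\<^sub>v g)"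
      by (simp only: Za[OF a] vnorm_power2 g_def)
    also have "\<dots> = (transpose_mat ?W *\<^sub>v (?W *\<^sub>v g)) \<bullet> g"
      using transpose_vec_mult_scalar[OF W g, of "?W *\<^sub>v g"] mult_mat_vec_carrier[OF W g] by simp
    also have "\<dots> = (?D *\<^sub>v g) \<bullet> g + real n * (vnorm g)\<^sup>2"
      unfolding WW[OF g] using g mult_mat_vec_carrier[OF Dc g]
      by (simp add: add_scalar_prod_distrib[of _ q] vnorm_power2)
    finally have 1: "(vnorm (Z *\<^sub>v a))\<^sup>2 = (?D *\<^sub>v g) \<bullet> g + real n * (vnorm g)\<^sup>2" .
    have "- ((?D *\<^sub>v g) \<bullet> g) = (- 1 \<cdot>\<^sub>v (?D *\<^sub>v g)) \<bullet> g"
      using g mult_mat_vec_carrier[OF Dc g] by simp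
    also have "\<dots> \<le> vnorm (- 1 \<cdot>\<^sub>v (?D *\<^sub>v g)) * vnorm g"
      using g mult_mat_vec_carrier[OF Dc g] by (intro scalar_prod_le_vnorm[of _ q]) auto
    also have "\<dots> = vnorm (?D *\<^sub>v g) * vnorm g" by (simp add: vnorm_smult del: scalar_prod_smult_distrib)
    also have "\<dots> \<le> real n / 2 * vnorm g * vnorm g"
      by (intro mult_right_mono Dg[OF g]) simp
    finally have 2: "real n / 2 * (vnorm g)\<^sup>2 \<le> (vnorm (Z *\<^sub>v a))\<^sup>2"
      unfolding 1 by (simp add: power2_eq_square algebra_simps)
    have "l * (vnorm a)\<^sup>2 = (sqrt l * vnorm a)\<^sup>2" using l by (simp add: power_mult_distrib)
    also have "\<dots> \<le> (vnorm g)\<^sup>2"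
      unfolding g_def using Va[OF a] l by (intro power_mono) auto
    finally have "real n / 2 * (l * (vnorm a)\<^sup>2) \<le> real n / 2 * (vnorm g)\<^sup>2"
      by (intro mult_left_mono) auto
    with 2 show ?thesis by (simp add: mult_ac)
  qed
  \<comment> \<open>The first-stage error \<open>d\<close> solves Z^T Z d = Z^T E v. In the
    coordinate \<open>g = V d\<close> this reads (?D + n I) g = ?M v, so (n / 2) |g| \<le> |?M v|.
    The bound \<open>M\<close> is chosen such that this yields |d| \<le> (s / 2) |v|, half of what
    \<open>\<Theta>\<close> guarantees.\<close>
  have T_low: "s / 2 * vnorm v \<le> vnorm (?T *\<^sub>v v)" if v: "v \<in> carrier_vec p" for v
  proof -
    define d where "d = ?T *\<^sub>v v - \<Theta> *\<^sub>v v"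
    have Tv: "?T *\<^sub>v v \<in> carrier_vec q" and Tv': "\<Theta> *\<^sub>v v \<in> carrier_vec q" and Ev: "E *\<^sub>v v \<in> carrier_vec n"
      using mult_mat_vec_carrier[OF T v] mult_mat_vec_carrier[OF carr(3) v]
        mult_mat_vec_carrier[OF carr(2) v] by auto
    have d: "d \<in> carrier_vec q" using Tv Tv' by (simp add: d_def)
    have Xv: "X *\<^sub>v v = Z *\<^sub>v (\<Theta> *\<^sub>v v) + E *\<^sub>v v"
      unfolding X add_mult_distrib_mat_vec[OF mult_carrier_mat[OF carr(1,3)] carr(2) v]
      assoc_mult_mat_vec[OF carr(1,3) v] ..
    have "Z *\<^sub>v d = Z *\<^sub>v (?T *\<^sub>v v) - Z *\<^sub>v (\<Theta> *\<^sub>v v)"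
      unfolding d_def by (rule mult_minus_distrib_mat_vec[OF carr(1) Tv Tv'])
    then have "transpose_mat Z *\<^sub>v (Z *\<^sub>v d)
        = transpose_mat Z *\<^sub>v (Z *\<^sub>v (?T *\<^sub>v v)) - transpose_mat Z *\<^sub>v (Z *\<^sub>v (\<Theta> *\<^sub>v v))"
      by (simp only: mult_minus_distrib_mat_vec[OF tc mult_mat_vec_carrier[OF carr(1) Tv]
          mult_mat_vec_carrier[OF carr(1) Tv']])
    also have "\<dots> = transpose_mat Z *\<^sub>v (E *\<^sub>v v)"
    proof -
      have "transpose_mat Z *\<^sub>v (X *\<^sub>v v)
          = transpose_mat Z *\<^sub>v (Z *\<^sub>v (\<Theta> *\<^sub>v v)) + transpose_mat Z *\<^sub>v (E *\<^sub>v v)"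
        unfolding Xv by (rule mult_add_distrib_mat_vec[OF tc mult_mat_vec_carrier[OF carr(1) Tv'] Ev])
      then show ?thesis
        unfolding normal1[OF v]
        using vec_add_minus_cancel(1)[OF mult_mat_vec_carrier[OF tc mult_mat_vec_carrier[OF carr(1) Tv']]
            mult_mat_vec_carrier[OF tc Ev]] by (simp only:)
    qed
    finally have Zd: "transpose_mat Z *\<^sub>v (Z *\<^sub>v d) = transpose_mat Z *\<^sub>v (E *\<^sub>v v)" .
    define g where "g = V *\<^sub>v d"
    have g: "g \<in> carrier_vec q" unfolding g_def by (rule mult_mat_vec_carrier[OF carr(7) d])
    have Mv: "?M *\<^sub>v v \<in> carrier_vec q" using mult_mat_vec_carrier[OF Mc v] .
    have Dgc: "?D *\<^sub>v g \<in> carrier_vec q" using mult_mat_vec_carrier[OF Dc g] .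
    have "?D *\<^sub>v g + real n \<cdot>\<^sub>v g = transpose_mat ?W *\<^sub>v (Z *\<^sub>v d)"
      unfolding Za[OF d] g_def[symmetric] WW[OF g] ..
    also have "\<dots> = transpose_mat ?W *\<^sub>v (E *\<^sub>v v)"
      using Zd tW[of "Z *\<^sub>v d"] tW[of "E *\<^sub>v v"] Ev mult_mat_vec_carrier[OF carr(1) d] by simp
    also have "\<dots> = ?M *\<^sub>v v"
      by (rule assoc_mult_mat_vec[OF tWc carr(2) v, symmetric])
    finally have eq: "?D *\<^sub>v g + real n \<cdot>\<^sub>v g = ?M *\<^sub>v v" .
    have "vnorm (real n \<cdot>\<^sub>v g) - vnorm (?D *\<^sub>v g) \<le> vnorm (real n \<cdot>\<^sub>v g + ?D *\<^sub>v g)"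
      using g Dgc by (intro vnorm_triangle_minus[of _ q]) auto
    also have "real n \<cdot>\<^sub>v g + ?D *\<^sub>v g = ?M *\<^sub>v v"
      unfolding eq[symmetric] using g Dgc by (intro comm_add_vec[of _ q]) auto
    finally have 1: "real n / 2 * vnorm g \<le> vnorm (?M *\<^sub>v v)"
      using Dg[OF g] by (simp add: vnorm_smult)
    have "vnorm (?M *\<^sub>v v) \<le> real n * sqrt l * s / 4 * vnorm v"
    proof (rule power2_le_imp_le)
      have "(vnorm (?M *\<^sub>v v))\<^sup>2 \<le> frobenius_sq ?M * (vnorm v)\<^sup>2"
        by (rule vnorm_mult_mat_vec_le[OF Mc v])
      also have "\<dots> \<le> (real n * sqrt l * s / 4)\<^sup>2 * (vnorm v)\<^sup>2"
        by (intro mult_right_mono M) simp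
      finally show "(vnorm (?M *\<^sub>v v))\<^sup>2 \<le> (real n * sqrt l * s / 4 * vnorm v)\<^sup>2"
        by (simp only: power_mult_distrib)
    qed (use l s in simp)
    with 1 have "real n / 2 * vnorm g \<le> real n / 2 * (sqrt l * (s / 2 * vnorm v))"
      by (simp add: mult_ac)
    then have "vnorm g \<le> sqrt l * (s / 2 * vnorm v)"
      by (rule mult_left_le_imp_le) (use n in simp)
    with Va[OF d] have "sqrt l * vnorm d \<le> sqrt l * (s / 2 * vnorm v)"
      by (simp add: g_def)
    then have "vnorm d \<le> s / 2 * vnorm v"
      by (rule mult_left_le_imp_le) (use l in simp)
    moreover have "vnorm (\<Theta> *\<^sub>v v) - vnorm d \<le> vnorm (\<Theta> *\<^sub>v v + d)"
      using Tv' d by (rule vnorm_triangle_minus)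
    moreover have "\<Theta> *\<^sub>v v + d = ?T *\<^sub>v v"
      unfolding d_def by (rule vec_add_minus_cancel(3)[OF Tv' Tv])
    ultimately show ?thesis using \<Theta>[OF v] by simp
  qed
  let ?H = "second_stage_gram Z X"
  have TZ [simp]: "transpose_mat ?T * transpose_mat Z \<in> carrier_mat p n"
    by (rule mult_carrier_mat[OF tT tc])
  have H: "?H \<in> carrier_mat p p"
    unfolding second_stage_gram_def by (rule mult_carrier_mat[OF mult_carrier_mat[OF TZ carr(1)] T])
  note Hi = mat_inv_invertible[OF H inv2]
  have Hv: "?H *\<^sub>v v = transpose_mat ?T *\<^sub>v (transpose_mat Z *\<^sub>v (Z *\<^sub>v (?T *\<^sub>v v)))"
    if v: "v \<in> carrier_vec p" for v
  proof -
    have Tv: "?T *\<^sub>v v \<in> carrier_vec q" using mult_mat_vec_carrier[OF T v] .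
    have ZTv: "Z *\<^sub>v (?T *\<^sub>v v) \<in> carrier_vec n" using mult_mat_vec_carrier[OF carr(1) Tv] .
    show ?thesis
      unfolding second_stage_gram_def
      by (simp only: assoc_mult_mat_vec[OF mult_carrier_mat[OF TZ carr(1)] T v]
          assoc_mult_mat_vec[OF TZ carr(1) Tv] assoc_mult_mat_vec[OF tT tc ZTv])
  qed
  define b where "b = beta_2sls Z X Y"
  have zY: "transpose_mat Z *\<^sub>v Y \<in> carrier_vec q" using mult_mat_vec_carrier[OF tc Yc] .
  have tzY: "transpose_mat ?T *\<^sub>v (transpose_mat Z *\<^sub>v Y) \<in> carrier_vec p"
    using mult_mat_vec_carrier[OF tT zY] .
  have b_eq: "b = mat_inv ?H *\<^sub>v (transpose_mat ?T *\<^sub>v (transpose_mat Z *\<^sub>v Y))"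
    unfolding b_def beta_2sls_def
    by (simp only: assoc_mult_mat_vec[OF mult_carrier_mat[OF Hi(1) tT] tc Yc]
        assoc_mult_mat_vec[OF Hi(1) tT zY])
  have b: "b \<in> carrier_vec p"
    unfolding b_eq using mult_mat_vec_carrier[OF Hi(1) tzY] .
  have Hb: "?H *\<^sub>v b = transpose_mat ?T *\<^sub>v (transpose_mat Z *\<^sub>v Y)"
    unfolding b_eq assoc_mult_mat_vec[OF H Hi(1) tzY, symmetric] Hi(2) using tzY by simp
  define \<delta> where "\<delta> = b - \<beta>"
  have \<delta>: "\<delta> \<in> carrier_vec p" using b by (simp add: \<delta>_def)
  have X\<beta>: "X *\<^sub>v \<beta> \<in> carrier_vec n" using mult_mat_vec_carrier[OF Xc carr(4)] .
  have ze: "transpose_mat Z *\<^sub>v e \<in> carrier_vec q" using mult_mat_vec_carrier[OF tc carr(5)] .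
  have zX: "transpose_mat Z *\<^sub>v (X *\<^sub>v \<beta>) \<in> carrier_vec q" using mult_mat_vec_carrier[OF tc X\<beta>] .
  \<comment> \<open>By \<open>normal1\<close>, \<open>\<beta>\<close> solves the second-stage
    equations exactly for the noiseless response X \<beta>; hence only the noise \<open>e\<close>
    survives on the right.\<close>
  have "?H *\<^sub>v \<delta> = ?H *\<^sub>v b - ?H *\<^sub>v \<beta>"
    unfolding \<delta>_def by (rule mult_minus_distrib_mat_vec[OF H b carr(4)])
  also have "?H *\<^sub>v \<beta> = transpose_mat ?T *\<^sub>v (transpose_mat Z *\<^sub>v (X *\<^sub>v \<beta>))"
    using Hv[of \<beta>] normal1[of \<beta>] by simp
  also have "?H *\<^sub>v b = transpose_mat ?T *\<^sub>v (transpose_mat Z *\<^sub>v (X *\<^sub>v \<beta>))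
      + transpose_mat ?T *\<^sub>v (transpose_mat Z *\<^sub>v e)"
    unfolding Hb Y mult_add_distrib_mat_vec[OF tc X\<beta> carr(5)]
    by (rule mult_add_distrib_mat_vec[OF tT zX ze])
  finally have H\<delta>: "?H *\<^sub>v \<delta> = transpose_mat ?T *\<^sub>v (transpose_mat Z *\<^sub>v e)"
    using vec_add_minus_cancel(1)[OF mult_mat_vec_carrier[OF tT zX] mult_mat_vec_carrier[OF tT ze]]
    by (simp only:)
  define a where "a = ?T *\<^sub>v \<delta>"
  have a: "a \<in> carrier_vec q" unfolding a_def using mult_mat_vec_carrier[OF T \<delta>] .
  have Zac: "Z *\<^sub>v a \<in> carrier_vec n" using mult_mat_vec_carrier[OF carr(1) a] .
  have zZa: "transpose_mat Z *\<^sub>v (Z *\<^sub>v a) \<in> carrier_vec q" using mult_mat_vec_carrier[OF tc Zac] .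
  have "(vnorm (Z *\<^sub>v a))\<^sup>2 = (transpose_mat Z *\<^sub>v (Z *\<^sub>v a)) \<bullet> a"
    unfolding vnorm_power2 using transpose_vec_mult_scalar[OF carr(1) a Zac] by simp
  also have "\<dots> = (?H *\<^sub>v \<delta>) \<bullet> \<delta>"
    unfolding Hv[OF \<delta>] a_def[symmetric]
    using transpose_vec_mult_scalar[OF T \<delta> zZa] by (simp add: a_def)
  also have "\<dots> = (transpose_mat Z *\<^sub>v e) \<bullet> a"
    unfolding H\<delta> using transpose_vec_mult_scalar[OF T \<delta> ze] by (simp add: a_def)
  also have "\<dots> \<le> vnorm (transpose_mat Z *\<^sub>v e) * vnorm a"
    using ze a by (rule scalar_prod_le_vnorm)
  finally have "real n / 2 * l * (vnorm a)\<^sup>2 \<le> vnorm (transpose_mat Z *\<^sub>v e) * vnorm a"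
    using lowZ[OF a] by linarith
  then have "vnorm a * (real n / 2 * l * vnorm a) \<le> vnorm a * vnorm (transpose_mat Z *\<^sub>v e)"
    by (simp add: power2_eq_square mult_ac)
  then have 1: "real n / 2 * l * vnorm a \<le> vnorm (transpose_mat Z *\<^sub>v e)"
    using vnorm_nonneg[of a] vnorm_nonneg[of "transpose_mat Z *\<^sub>v e"]
    by (cases "vnorm a = 0") (auto simp: mult_le_cancel_left simp del: times_divide_eq_left)
  have "real n / 2 * l * (s / 2 * vnorm \<delta>) \<le> real n / 2 * l * vnorm a"
    unfolding a_def using T_low[OF \<delta>] l by (intro mult_left_mono) auto
  with 1 have "real n / 2 * l * (s / 2 * vnorm \<delta>) \<le> vnorm (transpose_mat Z *\<^sub>v e)" by linarith
  then have "vnorm \<delta> \<le> 4 * vnorm (transpose_mat Z *\<^sub>v e) / (real n * l * s)"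
    using n l s by (simp add: field_simps)
  then show ?thesis by (simp add: \<delta>_def b_def)
qed

section \<open>Moments of sums of independent centred variables\<close>

text \<open>Induction on \<open>n\<close>: a new observation changes \<open>S\<close> by twice a
  linear term of mean zero plus \<open>\<Sum>i\<in>I. (\<xi> i x)\<^sup>2\<close>. Independence is
  used between observations only, so the coordinates \<open>\<xi> i\<close> of one observation may
  depend on each other arbitrarily. The bound \<open>B\<close> serves integrability and does not
  enter the estimates.\<close>

lemma sum_squares_moments:
  fixes \<xi> :: "'i \<Rightarrow> 'a \<Rightarrow> real" and P :: "'a measure"
  assumes P: "prob_space P" and I: "finite I"
    and meas: "\<And>i. i \<in> I \<Longrightarrow> \<xi> i \<in> borel_measurable P"
    and bdd: "\<And>i. i \<in> I \<Longrightarrow> AE x in P. \<bar>\<xi> i x\<bar> \<le> B"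
    and centred: "\<And>i. i \<in> I \<Longrightarrow> (LINT x|P. \<xi> i x) = 0"
  defines "S \<equiv> \<lambda>n \<omega>. \<Sum>i\<in>I. (\<Sum>k<n. \<xi> i (\<omega> k))\<^sup>2"
    and "v \<equiv> LINT x|P. (\<Sum>i\<in>I. (\<xi> i x)\<^sup>2)"
    and "m \<equiv> LINT x|P. (\<Sum>i\<in>I. (\<xi> i x)\<^sup>2)\<^sup>2"
  shows "integrable (PiM {..<n} (\<lambda>_. P)) (S n)"
    and "(LINT \<omega>|PiM {..<n} (\<lambda>_. P). S n \<omega>) = real n * v"
    and "integrable (PiM {..<n} (\<lambda>_. P)) (\<lambda>\<omega>. (S n \<omega>)\<^sup>2)"
    and "(LINT \<omega>|PiM {..<n} (\<lambda>_. P). (S n \<omega>)\<^sup>2) \<le> 4 * (real n)\<^sup>2 * v\<^sup>2 + 3 * real n * m"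
proof -
  interpret P: prob_space P by (rule P)
  interpret PP: product_sigma_finite "\<lambda>_::nat. P" by unfold_locales
  have prob: "prob_space (PiM {..<n} (\<lambda>_. P))" for n :: nat
    by (rule prob_space_PiM) (rule P)
  have [measurable]: "\<xi> i \<in> borel_measurable P" if "i \<in> I" for i
    by (rule meas[OF that])
  have S_meas [measurable]: "S n \<in> borel_measurable (PiM {..<n} (\<lambda>_. P))" for n
  proof -
    have "(\<lambda>\<omega>. \<xi> i (\<omega> k)) \<in> borel_measurable (PiM {..<n} (\<lambda>_. P))" if "i \<in> I" "k < n" for i k
      using measurable_compose[OF measurable_component_singleton[of k "{..<n}" "\<lambda>_. P"]
          meas[OF that(1)]] that(2) by simp
    then show ?thesis
      unfolding S_def by (intro borel_measurable_sum borel_measurable_power) auto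
  qed
  have bdd_all: "AE x in P. \<forall>i\<in>I. \<bar>\<xi> i x\<bar> \<le> B"
    using I bdd by (intro AE_finite_allI) auto
  define c where "c = (\<lambda>n. real (card I) * (real n * B)\<^sup>2)"
  have S_bdd: "AE \<omega> in PiM {..<n} (\<lambda>_. P). \<bar>S n \<omega>\<bar> \<le> c n" for n
  proof -
    have "AE \<omega> in PiM {..<n} (\<lambda>_. P). \<forall>k\<in>{..<n}. \<forall>i\<in>I. \<bar>\<xi> i (\<omega> k)\<bar> \<le> B"
    proof (rule AE_finite_allI)
      fix k assume "k \<in> {..<n}"
      then show "AE \<omega> in PiM {..<n} (\<lambda>_. P). \<forall>i\<in>I. \<bar>\<xi> i (\<omega> k)\<bar> \<le> B"
        using AE_PiM_component[of "{..<n}" "\<lambda>_. P" k "\<lambda>x. \<forall>i\<in>I. \<bar>\<xi> i x\<bar> \<le> B"] bdd_all P by simp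
    qed simp
    then show ?thesis
    proof eventually_elim
      case (elim \<omega>)
      have "(\<Sum>i\<in>I. (\<Sum>k<n. \<xi> i (\<omega> k))\<^sup>2) \<le> (\<Sum>i\<in>I. (real n * B)\<^sup>2)"
      proof (rule sum_mono)
        fix i assume i: "i \<in> I"
        have "\<bar>\<Sum>k<n. \<xi> i (\<omega> k)\<bar> \<le> (\<Sum>k<n. B)"
          using elim i by (intro order_trans[OF sum_abs] sum_mono) auto
        then show "(\<Sum>k<n. \<xi> i (\<omega> k))\<^sup>2 \<le> (real n * B)\<^sup>2"
          using abs_le_square_iff[of "\<Sum>k<n. \<xi> i (\<omega> k)" "real n * B"] by simp
      qed
      then show ?case by (simp add: S_def c_def abs_of_nonneg sum_nonneg)
    qed
  qed
  have int_S: "integrable (PiM {..<n} (\<lambda>_. P)) (S n)" for n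
    by (rule finite_measure.integrable_const_bound[OF prob_space.finite_measure[OF prob], of _ "c n"])
      (use S_bdd[of n] in simp, rule S_meas)
  have int_S2: "integrable (PiM {..<n} (\<lambda>_. P)) (\<lambda>\<omega>. (S n \<omega>)\<^sup>2)" for n
  proof (rule finite_measure.integrable_const_bound[OF prob_space.finite_measure[OF prob]])
    show "AE \<omega> in PiM {..<n} (\<lambda>_. P). norm ((S n \<omega>)\<^sup>2) \<le> (c n)\<^sup>2"
      using S_bdd[of n]
    proof eventually_elim
      case (elim \<omega>)
      then show ?case using power_mono[OF elim abs_ge_zero, of 2] by simp
    qed
    show "(\<lambda>\<omega>. (S n \<omega>)\<^sup>2) \<in> borel_measurable (PiM {..<n} (\<lambda>_. P))"
      by (rule borel_measurable_power[OF S_meas])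
  qed
  have int_\<xi>: "integrable P (\<xi> i)" if "i \<in> I" for i
    by (rule P.integrable_const_bound[of _ B]) (use bdd[OF that] in simp, rule meas[OF that])
  define q where "q = (\<lambda>x. \<Sum>i\<in>I. (\<xi> i x)\<^sup>2)"
  have q_meas [measurable]: "q \<in> borel_measurable P"
    unfolding q_def by (intro borel_measurable_sum borel_measurable_power meas)
  have q_bdd: "AE x in P. \<bar>q x\<bar> \<le> real (card I) * B\<^sup>2"
    using bdd_all
  proof eventually_elim
    case (elim x)
    have "q x \<le> (\<Sum>i\<in>I. B\<^sup>2)"
      unfolding q_def
    proof (rule sum_mono)
      fix i assume "i \<in> I"
      then have "\<bar>\<xi> i x\<bar> \<le> B" using elim by blast
      then have "\<bar>\<xi> i x\<bar> \<le> \<bar>B\<bar>" by linarith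
      then show "(\<xi> i x)\<^sup>2 \<le> B\<^sup>2" by (simp add: abs_le_square_iff)
    qed
    then show ?case by (simp add: q_def abs_of_nonneg sum_nonneg)
  qed
  have int_q: "integrable P q"
    by (rule P.integrable_const_bound[of _ "real (card I) * B\<^sup>2"]) (use q_bdd in simp, rule q_meas)
  have int_q2: "integrable P (\<lambda>x. (q x)\<^sup>2)"
  proof (rule P.integrable_const_bound)
    show "AE x in P. norm ((q x)\<^sup>2) \<le> (real (card I) * B\<^sup>2)\<^sup>2"
      using q_bdd
    proof eventually_elim
      case (elim x)
      then show ?case using power_mono[OF elim abs_ge_zero, of 2] by simp
    qed
    show "(\<lambda>x. (q x)\<^sup>2) \<in> borel_measurable P"
      by (rule borel_measurable_power[OF q_meas])
  qed
  have v: "v = (LINT x|P. q x)" and m: "m = (LINT x|P. (q x)\<^sup>2)"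
    by (simp_all add: v_def m_def q_def)
  define D where "D = (\<lambda>s x. \<Sum>i\<in>I. s i * \<xi> i x)"
  have int_D: "integrable P (D s)" and D0: "(LINT x|P. D s x) = 0" for s
    using int_\<xi> centred by (simp_all add: D_def)
  have step: "S (Suc n) (fun_upd \<omega> n x)
      = S n \<omega> + 2 * D (\<lambda>i. \<Sum>k<n. \<xi> i (\<omega> k)) x + q x" for n \<omega> x
  proof -
    have "(\<Sum>k<n. \<xi> i ((fun_upd \<omega> n x) k)) = (\<Sum>k<n. \<xi> i (\<omega> k))" for i
      by (intro sum.cong) auto
    then have "S (Suc n) (fun_upd \<omega> n x) = (\<Sum>i\<in>I. ((\<Sum>k<n. \<xi> i (\<omega> k)) + \<xi> i x)\<^sup>2)"
      by (simp add: S_def)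
    also have "\<dots> = S n \<omega> + 2 * D (\<lambda>i. \<Sum>k<n. \<xi> i (\<omega> k)) x + q x"
      by (simp add: S_def D_def q_def power2_sum sum.distrib sum_distrib_left mult_ac)
    finally show ?thesis .
  qed
  \<comment> \<open>The newest observation is integrated first, with the earlier ones fixed, so that
    \<open>D\<close> has constant coefficients and averages to zero.\<close>
  have rec: "(LINT \<omega>|PiM {..<Suc n} (\<lambda>_. P). f \<omega>)
      = (LINT \<omega>|PiM {..<n} (\<lambda>_. P). LINT x|P. f (fun_upd \<omega> n x))"
    if "integrable (PiM {..<Suc n} (\<lambda>_. P)) f" for n and f :: "(nat \<Rightarrow> 'a) \<Rightarrow> real"
    using PP.product_integral_insert[of "{..<n}" n f] that by (simp add: lessThan_Suc)
  have E: "(LINT \<omega>|PiM {..<n} (\<lambda>_. P). S n \<omega>) = real n * v" for n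
  proof (induction n)
    case 0
    then show ?case by (simp add: S_def)
  next
    case (Suc n)
    interpret N: prob_space "PiM {..<n} (\<lambda>_. P)" by (rule prob)
    have "(LINT x|P. S (Suc n) (fun_upd \<omega> n x)) = S n \<omega> + v" for \<omega>
      unfolding step v using int_D int_q D0 by (simp add: P.prob_space)
    then show ?case
      using Suc int_S[of n] by (simp add: rec[OF int_S] N.prob_space algebra_simps)
  qed
  have E2: "(LINT \<omega>|PiM {..<n} (\<lambda>_. P). (S n \<omega>)\<^sup>2) \<le> 4 * (real n)\<^sup>2 * v\<^sup>2 + 3 * real n * m" for n
  proof (induction n)
    case 0
    then show ?case by (simp add: S_def)
  next
    case (Suc n)
    interpret N: prob_space "PiM {..<n} (\<lambda>_. P)" by (rule prob)
    have S0: "0 \<le> S n \<omega>" and q0: "0 \<le> q x" for \<omega> x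
      by (simp_all add: S_def q_def sum_nonneg)
    have v0: "0 \<le> v" unfolding v using q0 by simp
    have m0: "0 \<le> m" unfolding m by simp
    have bound: "(LINT x|P. (S (Suc n) (fun_upd \<omega> n x))\<^sup>2) \<le> (S n \<omega>)\<^sup>2 + 8 * S n \<omega> * v + 3 * m" for \<omega>
    proof -
      let ?D = "D (\<lambda>i. \<Sum>k<n. \<xi> i (\<omega> k))"
      have pt: "(S (Suc n) (fun_upd \<omega> n x))\<^sup>2
          \<le> (S n \<omega>)\<^sup>2 + 4 * S n \<omega> * ?D x + 8 * S n \<omega> * q x + 3 * (q x)\<^sup>2" for x
      proof -
        \<comment> \<open>Expand and use 4 b^2 \<le> 4 a c and 4 b c \<le> 2 b^2 + 2 c^2 \<le> 2 a c
          + 2 c^2. The term 4 a b is kept as it stands because its mean is zero.\<close>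
        have ineq: "(a + 2 * b + c)\<^sup>2 \<le> a\<^sup>2 + 4 * a * b + 8 * a * c + 3 * c\<^sup>2"
          if "b\<^sup>2 \<le> a * c" for a b c :: real
          using that zero_le_power2[of "b - c"] by (simp add: power2_eq_square algebra_simps)
        have "(?D x)\<^sup>2 \<le> S n \<omega> * q x"
          unfolding D_def S_def q_def by (rule Cauchy_Schwarz_ineq_sum)
        then show ?thesis
          unfolding step by (rule ineq)
      qed
      have "(LINT x|P. (S (Suc n) (fun_upd \<omega> n x))\<^sup>2)
          \<le> (LINT x|P. (S n \<omega>)\<^sup>2 + 4 * S n \<omega> * ?D x + 8 * S n \<omega> * q x + 3 * (q x)\<^sup>2)"
      proof (rule integral_mono'[OF _ pt])
        show "integrable P (\<lambda>x. (S n \<omega>)\<^sup>2 + 4 * S n \<omega> * ?D x + 8 * S n \<omega> * q x + 3 * (q x)\<^sup>2)"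
          using int_D int_q int_q2 by simp
        show "0 \<le> (S n \<omega>)\<^sup>2 + 4 * S n \<omega> * ?D x + 8 * S n \<omega> * q x + 3 * (q x)\<^sup>2" for x
          by (rule order_trans[OF zero_le_power2 pt])
      qed
      also have "\<dots> = (S n \<omega>)\<^sup>2 + 8 * S n \<omega> * v + 3 * m"
        unfolding v m using int_D int_q int_q2 D0 by (simp add: P.prob_space)
      finally show ?thesis .
    qed
    have "(LINT \<omega>|PiM {..<Suc n} (\<lambda>_. P). (S (Suc n) \<omega>)\<^sup>2)
        \<le> (LINT \<omega>|PiM {..<n} (\<lambda>_. P). (S n \<omega>)\<^sup>2 + 8 * S n \<omega> * v + 3 * m)"
      unfolding rec[OF int_S2] using int_S int_S2 bound S0 v0 m0
      by (intro integral_mono') auto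
    also have "\<dots> = (LINT \<omega>|PiM {..<n} (\<lambda>_. P). (S n \<omega>)\<^sup>2) + 8 * (real n * v) * v + 3 * m"
      using int_S int_S2 E[of n] by (simp add: N.prob_space)
    also have "\<dots> \<le> 4 * (real n)\<^sup>2 * v\<^sup>2 + 3 * real n * m + 8 * (real n * v) * v + 3 * m"
      using Suc by simp
    \<comment> \<open>The increment 8 n v^2 fits between 4 n^2 v^2 and 4 (n + 1)^2 v^2, which is
      where the factor 4 comes from.\<close>
    also have "\<dots> \<le> 4 * (real (Suc n))\<^sup>2 * v\<^sup>2 + 3 * real (Suc n) * m"
      using zero_le_power2[of v] by (simp add: power2_eq_square algebra_simps)
    finally show ?case .
  qed
  show "integrable (PiM {..<n} (\<lambda>_. P)) (S n)"
    and "(LINT \<omega>|PiM {..<n} (\<lambda>_. P). S n \<omega>) = real n * v"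
    and "integrable (PiM {..<n} (\<lambda>_. P)) (\<lambda>\<omega>. (S n \<omega>)\<^sup>2)"
    and "(LINT \<omega>|PiM {..<n} (\<lambda>_. P). (S n \<omega>)\<^sup>2) \<le> 4 * (real n)\<^sup>2 * v\<^sup>2 + 3 * real n * m"
    using int_S E int_S2 E2 by auto
qed

section \<open>Moments in the instrumental variable model\<close>

lemma abs_index_le_vnorm:
  assumes "v \<in> carrier_vec n" "i < n"
  shows "\<bar>v $ i\<bar> \<le> vnorm v"
proof -
  have "(v $ i)\<^sup>2 \<le> (\<Sum>i<n. (v $ i)\<^sup>2)"
    using assms(2) by (intro member_le_sum) auto
  also have "\<dots> = (vnorm v)\<^sup>2"
    unfolding vnorm_power2 using assms(1) by (simp add: scalar_prod_real_vec power2_eq_square)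
  finally have "(v $ i)\<^sup>2 \<le> (vnorm v)\<^sup>2" .
  then show ?thesis
    using abs_le_square_iff[of "v $ i" "vnorm v"] by simp
qed

text \<open>With \<open>p = 0\<close> the correlation matrix would be empty and thereby equal to the
  zero matrix.\<close>

lemma iv_assumption_dims:
  assumes "iv_assumption n p q \<Theta> P"
  shows "0 < p" "p \<le> q"
proof -
  have ne: "correlation_mat q p P (instrument q) (regressor p q \<Theta>) \<noteq> 0\<^sub>m q p"
    using assms by (auto simp: iv_assumption_def)
  show "0 < p"
  proof (rule ccontr)
    assume "\<not> 0 < p"
    then have "correlation_mat q p P (instrument q) (regressor p q \<Theta>) = 0\<^sub>m q p"
      by (intro eq_matI) (auto simp: correlation_mat_def)
    with ne show False by simp
  qed
  show "p \<le> q" using assms by (simp add: iv_assumption_def)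
qed

text \<open>The conditions on the sample size are kept out of this context, so the moment bounds
  hold for every positive \<open>n\<close>. In the theorem \<open>n_pos\<close> follows from the
  second condition.\<close>

locale iv_model =
  fixes n p q :: nat and \<beta> :: "real vec" and \<Theta> :: "real mat" and \<sigma>\<^sub>1 :: real
    and \<Sigma>\<^sub>2 :: "real mat" and P :: "obs measure" and B\<beta> B\<Theta> Bz Bx B\<epsilon>\<^sub>1 B\<epsilon>\<^sub>2 :: real
  assumes model: "linear_model p q \<beta> \<Theta> \<sigma>\<^sub>1 \<Sigma>\<^sub>2 P"
    and iv: "iv_assumption n p q \<Theta> P"
    and reg: "regularity p q \<beta> \<Theta> P B\<beta> B\<Theta> Bz Bx B\<epsilon>\<^sub>1 B\<epsilon>\<^sub>2"
    and lambda_pos: "0 < lambda_min (sigma_z q P)"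
    and sigma_pos: "0 < sigma_min \<Theta>"
    and Bz_pos: "0 < Bz" and B\<epsilon>\<^sub>2_pos: "0 < B\<epsilon>\<^sub>2" and n_pos: "0 < n"
begin

abbreviation z :: "nat \<Rightarrow> obs \<Rightarrow> real" where "z j w \<equiv> fst w j"
abbreviation e :: "nat \<Rightarrow> obs \<Rightarrow> real" where "e k w \<equiv> snd (snd w) k"
abbreviation lam :: real where "lam \<equiv> lambda_min (sigma_z q P)"
abbreviation sig :: real where "sig \<equiv> sigma_min \<Theta>"

section \<open>Measurability, almost sure bounds and moments of a single observation\<close>

lemma prob_P: "prob_space P" and sets_P: "sets P = sets (obs_space p q)"
  and carrier_\<beta>: "\<beta> \<in> carrier_vec p" and carrier_\<Theta>: "\<Theta> \<in> carrier_mat q p"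
  using model by (auto simp: linear_model_def)

sublocale P: prob_space P
  by (rule prob_P)

lemma fst_measurable: "fst \<in> measurable P (PiM {..<q} (\<lambda>_. borel))"
  unfolding measurable_cong_sets[OF sets_P refl] by (simp add: obs_space_def)

lemma z_measurable [measurable]: "j < q \<Longrightarrow> z j \<in> borel_measurable P"
  using measurable_compose[OF fst_measurable measurable_component_singleton[of j "{..<q}" "\<lambda>_. borel"]]
  by simp

lemma noise1_measurable [measurable]: "noise1 \<in> borel_measurable P"
  unfolding noise1_def measurable_cong_sets[OF sets_P refl] by (simp add: obs_space_def)

lemma e_measurable [measurable]:
  assumes "k < p"
  shows "e k \<in> borel_measurable P"
proof -
  have "(\<lambda>w. snd (snd w)) \<in> measurable P (PiM {..<p} (\<lambda>_. borel))"
    unfolding measurable_cong_sets[OF sets_P refl] by (simp add: obs_space_def)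
  from measurable_compose[OF this measurable_component_singleton[of k "{..<p}" "\<lambda>_. borel"]]
  show ?thesis using assms by simp
qed

lemma sum_z_sq: "(\<Sum>j<q. (z j w)\<^sup>2) = (vnorm (instrument q w))\<^sup>2"
  unfolding vnorm_power2 by (simp add: scalar_prod_real_vec instrument_def power2_eq_square)

lemma sum_e_sq: "(\<Sum>k<p. (e k w)\<^sup>2) = (vnorm (noise2 p w))\<^sup>2"
  unfolding vnorm_power2 by (simp add: scalar_prod_real_vec noise2_def power2_eq_square)

lemma AE_z_sq: "AE w in P. (\<Sum>j<q. (z j w)\<^sup>2) \<le> Bz\<^sup>2"
proof -
  have "AE w in P. vnorm (instrument q w) \<le> Bz" using reg by (auto simp: regularity_def)
  then show ?thesis
    by eventually_elim (simp add: sum_z_sq power_mono)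
qed

lemma AE_e_sq: "AE w in P. (\<Sum>k<p. (e k w)\<^sup>2) \<le> B\<epsilon>\<^sub>2\<^sup>2"
proof -
  have "AE w in P. vnorm (noise2 p w) \<le> B\<epsilon>\<^sub>2" using reg by (auto simp: regularity_def)
  then show ?thesis
    by eventually_elim (simp add: sum_e_sq power_mono)
qed

lemma AE_noise1: "AE w in P. \<bar>noise1 w\<bar> \<le> B\<epsilon>\<^sub>1"
  using reg by (auto simp: regularity_def)

lemma AE_z: "j < q \<Longrightarrow> AE w in P. \<bar>z j w\<bar> \<le> Bz"
proof -
  assume j: "j < q"
  have "AE w in P. vnorm (instrument q w) \<le> Bz" using reg by (auto simp: regularity_def)
  then show ?thesis
  proof eventually_elim
    case (elim w)
    then show ?case
      using abs_index_le_vnorm[of "instrument q w" q j] j by (simp add: instrument_def)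
  qed
qed

lemma AE_e: "k < p \<Longrightarrow> AE w in P. \<bar>e k w\<bar> \<le> B\<epsilon>\<^sub>2"
proof -
  assume k: "k < p"
  have "AE w in P. vnorm (noise2 p w) \<le> B\<epsilon>\<^sub>2" using reg by (auto simp: regularity_def)
  then show ?thesis
  proof eventually_elim
    case (elim w)
    then show ?case
      using abs_index_le_vnorm[of "noise2 p w" p k] k by (simp add: noise2_def)
  qed
qed

lemma integrable_mult_bounded:
  assumes "f \<in> borel_measurable P" "g \<in> borel_measurable P"
    and f: "AE w in P. \<bar>f w\<bar> \<le> a" and g: "AE w in P. \<bar>g w\<bar> \<le> (b::real)"
  shows "integrable P (\<lambda>w. f w * g w)"
proof (rule P.integrable_const_bound)
  show "AE w in P. norm (f w * g w) \<le> a * b"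
    using f g by eventually_elim (simp add: abs_mult mult_mono')
  show "(\<lambda>w. f w * g w) \<in> borel_measurable P" using assms by simp
qed

lemma integrable_zz: "i < q \<Longrightarrow> j < q \<Longrightarrow> integrable P (\<lambda>w. z i w * z j w)"
  by (intro integrable_mult_bounded[OF _ _ AE_z AE_z] z_measurable)

lemma integrable_ze: "j < q \<Longrightarrow> k < p \<Longrightarrow> integrable P (\<lambda>w. z j w * e k w)"
  by (intro integrable_mult_bounded[OF _ _ AE_z AE_e] z_measurable e_measurable)

lemma expectation_z: "j < q \<Longrightarrow> (LINT w|P. z j w) = 0"
  using reg by (simp add: regularity_def instrument_def)

lemma sigma_z_carrier: "sigma_z q P \<in> carrier_mat q q"
  by (simp add: sigma_z_def second_moment_mat_def)

lemma sigma_z_index: "i < q \<Longrightarrow> j < q \<Longrightarrow> sigma_z q P $$ (i, j) = (LINT w|P. z i w * z j w)"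
  by (simp add: sigma_z_def second_moment_mat_def instrument_def)

lemma sigma_z_symmetric: "transpose_mat (sigma_z q P) = sigma_z q P"
  using sigma_z_carrier by (intro eq_matI) (auto simp: sigma_z_index mult.commute)

lemma sigma_z_ge: "v \<in> carrier_vec q \<Longrightarrow> lam * (vnorm v)\<^sup>2 \<le> v \<bullet> (sigma_z q P *\<^sub>v v)"
  by (rule lambda_min_le[OF sigma_z_carrier sigma_z_symmetric])

lemma regressor_index:
  assumes "k < p"
  shows "regressor p q \<Theta> w $ k = col \<Theta> k \<bullet> instrument q w + e k w"
  using assms carrier_\<Theta> by (simp add: regressor_def noise2_def)

text \<open>By the tower property E[z_j x_k] = E[z_j E[x_k | z]], and the regularity condition
  identifies the inner expectation with the linear part of x_k. Subtracting that part leaves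
  E[z_j \<epsilon>2_k] = 0; orthogonality of instrument and second noise is thus derived, not
  assumed.\<close>

lemma expectation_ze:
  assumes j: "j < q" and k: "k < p"
  shows "(LINT w|P. z j w * e k w) = 0"
proof -
  let ?F = "vimage_algebra (space P) fst (PiM {..<q} (\<lambda>_. borel :: real measure))"
  have sub: "subalgebra P ?F"
    unfolding subalgebra_def using sets_image_in_sets[OF refl fst_measurable] by simp
  interpret F: finite_measure_subalgebra P ?F
    by unfold_locales (rule sub)
  have "fst \<in> measurable ?F (PiM {..<q} (\<lambda>_. borel :: real measure))"
    by (rule measurable_vimage_algebra1) (use measurable_space[OF fst_measurable] in auto)
  from measurable_compose[OF this measurable_component_singleton[of j "{..<q}" "\<lambda>_. borel"]]
  have zF: "z j \<in> borel_measurable ?F" using j by simp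
  let ?x = "\<lambda>w. regressor p q \<Theta> w $ k" and ?m = "\<lambda>w. col \<Theta> k \<bullet> instrument q w"
  have m_eq: "?m w = (\<Sum>i<q. \<Theta> $$ (i, k) * z i w)" for w
    using carrier_\<Theta> k by (simp add: scalar_prod_real_vec instrument_def)
  have [measurable]: "?m \<in> borel_measurable P"
    unfolding m_eq by (intro borel_measurable_sum borel_measurable_times z_measurable) auto
  have x_eq: "?x w = ?m w + e k w" for w by (rule regressor_index[OF k])
  have x_meas: "?x \<in> borel_measurable P"
    unfolding x_eq using e_measurable[OF k] by simp
  have int_m: "integrable P (\<lambda>w. z j w * ?m w)"
  proof -
    have "z j w * ?m w = (\<Sum>i<q. \<Theta> $$ (i, k) * (z j w * z i w))" for w
      unfolding m_eq sum_distrib_left by (simp add: mult_ac)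
    then show ?thesis
      using integrable_zz[OF j] by (auto intro!: Bochner_Integration.integrable_sum)
  qed
  have int_x: "integrable P (\<lambda>w. z j w * ?x w)"
    unfolding x_eq distrib_left using int_m integrable_ze[OF j k] by simp
  have "(LINT w|P. z j w * ?x w) = (LINT w|P. z j w * real_cond_exp P ?F ?x w)"
    using F.real_cond_exp_intg(2)[OF int_x zF x_meas] by simp
  also have "\<dots> = (LINT w|P. z j w * ?m w)"
  proof (rule integral_cong_AE)
    have "AE w in P. real_cond_exp P ?F ?x w = ?m w"
      using reg k by (simp add: regularity_def)
    then show "AE w in P. z j w * real_cond_exp P ?F ?x w = z j w * ?m w"
      by eventually_elim simp
  qed (use z_measurable[OF j] in measurable)
  finally have "(LINT w|P. z j w * ?m w + z j w * e k w) = (LINT w|P. z j w * ?m w)"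
    by (simp only: x_eq distrib_left)
  then show ?thesis using int_m integrable_ze[OF j k] by simp
qed

lemma expectation_noise1_sq: "(LINT w|P. (noise1 w)\<^sup>2) = \<sigma>\<^sub>1\<^sup>2"
proof -
  have "covariance P noise1 noise1 = \<sigma>\<^sub>1\<^sup>2" "(LINT w|P. noise1 w) = 0"
    using model by (auto simp: linear_model_def)
  then show ?thesis by (simp add: covariance_def power2_eq_square)
qed

lemma integrable_noise1_sq: "integrable P (\<lambda>w. (noise1 w)\<^sup>2)"
  using model by (simp add: linear_model_def)

text \<open>A vanishing correlation may be due to a degenerate variance: that of the instrument is
  excluded by the positive definiteness of its second moments, and a noise of variance zero is
  almost surely zero.\<close>
lemma expectation_z_noise1:
  assumes j: "j < q"
  shows "(LINT w|P. z j w * noise1 w) = 0"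
proof -
  have n0: "(LINT w|P. noise1 w) = 0" using model by (simp add: linear_model_def)
  have "correlation_vec q P (instrument q) noise1 $ j = 0"
    using iv j by (simp add: iv_assumption_def)
  then have "(LINT w|P. z j w * noise1 w)
      / sqrt ((LINT w|P. z j w * z j w) * (LINT w|P. noise1 w * noise1 w)) = 0"
    using j n0 expectation_z[OF j]
    by (simp add: correlation_vec_def correlation_def covariance_def instrument_def)
  then have "(LINT w|P. z j w * noise1 w) = 0 \<or> (LINT w|P. z j w * z j w) = 0
      \<or> (LINT w|P. noise1 w * noise1 w) = 0" by auto
  moreover have "(LINT w|P. z j w * z j w) > 0"
  proof -
    have "lam * (vnorm (unit_vec q j))\<^sup>2 \<le> unit_vec q j \<bullet> (sigma_z q P *\<^sub>v unit_vec q j)"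
      by (rule sigma_z_ge) simp
    then have "lam \<le> (LINT w|P. z j w * z j w)"
      using j sigma_z_carrier by (simp add: vnorm_power2 sigma_z_index[symmetric])
    then show ?thesis using lambda_pos by linarith
  qed
  moreover have ?thesis if "(LINT w|P. noise1 w * noise1 w) = 0"
  proof -
    have "AE w in P. noise1 w * noise1 w = 0"
      using integral_nonneg_eq_0_iff_AE[of P "\<lambda>w. noise1 w * noise1 w"] that integrable_noise1_sq
      by (simp add: power2_eq_square)
    then have "(LINT w|P. z j w * noise1 w) = (LINT w|P. 0)"
      using j by (intro integral_cong_AE) (auto simp: z_measurable)
    then show ?thesis by simp
  qed
  ultimately show ?thesis by auto
qed

section \<open>The whitened instrument and its empirical moments\<close>

lemma whitening:
  obtains U V where "U \<in> carrier_mat q q" "V \<in> carrier_mat q q" "U * V = 1\<^sub>m q"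
    "transpose_mat U * sigma_z q P * U = 1\<^sub>m q"
    "\<And>v. v \<in> carrier_vec q \<Longrightarrow> vnorm (U *\<^sub>v v) \<le> vnorm v / sqrt lam"
    "\<And>v. v \<in> carrier_vec q \<Longrightarrow> vnorm (transpose_mat U *\<^sub>v v) \<le> vnorm v / sqrt lam"
proof -
  note \<Sigma> = sigma_z_carrier
  have pd: "0 < v \<bullet> (sigma_z q P *\<^sub>v v)" if v: "v \<in> carrier_vec q" "v \<noteq> 0\<^sub>v q" for v
  proof -
    have "vnorm v \<noteq> 0" using vnorm_eq_0_iff[OF v(1)] v(2) by simp
    then have "0 < lam * (vnorm v)\<^sup>2" using lambda_pos by simp
    then show ?thesis using sigma_z_ge[OF v(1)] by linarith
  qed
  obtain U where U: "U \<in> carrier_mat q q" "transpose_mat U * sigma_z q P * U = 1\<^sub>m q"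
    using whitening_matrix[OF \<Sigma> sigma_z_symmetric pd] by blast
  \<comment> \<open>The whitening identity says V U = I; for square matrices this is also U V =
    I.\<close>
  define V where "V = transpose_mat U * sigma_z q P"
  have V: "V \<in> carrier_mat q q"
    unfolding V_def by (rule mult_carrier_mat[OF transpose_carrier_mat[THEN iffD2, OF U(1)] \<Sigma>])
  have "U * V = 1\<^sub>m q"
    using mat_mult_left_right_inverse[OF V U(1)] U(2) by (simp add: V_def)
  then show ?thesis
    using that[OF U(1) V _ U(2)]
      whitening_vnorm_le[OF \<Sigma> U lambda_pos sigma_z_ge] by blast
qed

text \<open>Coordinate \<open>j\<close> of U^T z, written as a sum of real functions so that
  measurability and integration apply coordinatewise.\<close>

definition white :: "real mat \<Rightarrow> nat \<Rightarrow> obs \<Rightarrow> real" where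
  "white U j w = (\<Sum>i<q. U $$ (i, j) * z i w)"

context
  fixes U :: "real mat" assumes U: "U \<in> carrier_mat q q"
    and whitens: "transpose_mat U * sigma_z q P * U = 1\<^sub>m q"
    and U_bound: "\<And>v. v \<in> carrier_vec q \<Longrightarrow> vnorm (transpose_mat U *\<^sub>v v) \<le> vnorm v / sqrt lam"
begin

lemma white_eq: "j < q \<Longrightarrow> white U j w = (transpose_mat U *\<^sub>v instrument q w) $ j"
  using U by (simp add: white_def scalar_prod_real_vec instrument_def)

lemma white_measurable [measurable]: "white U j \<in> borel_measurable P"
  unfolding white_def by (intro borel_measurable_sum borel_measurable_times z_measurable) auto

lemma AE_white_sq: "AE w in P. (\<Sum>j<q. (white U j w)\<^sup>2) \<le> Bz\<^sup>2 / lam"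
proof -
  have "AE w in P. vnorm (instrument q w) \<le> Bz" using reg by (auto simp: regularity_def)
  then show ?thesis
  proof eventually_elim
    case (elim w)
    let ?v = "transpose_mat U *\<^sub>v instrument q w"
    have i: "instrument q w \<in> carrier_vec q" by (simp add: instrument_def)
    have "(\<Sum>j<q. (white U j w)\<^sup>2) = (vnorm ?v)\<^sup>2"
      unfolding vnorm_power2 scalar_prod_real_vec[of _ ?v] using U
      by (simp add: white_eq power2_eq_square)
    also have "\<dots> \<le> (Bz / sqrt lam)\<^sup>2"
    proof (rule power_mono)
      show "vnorm ?v \<le> Bz / sqrt lam"
        using order_trans[OF U_bound[OF i] divide_right_mono[OF elim]] lambda_pos by simp
    qed simp
    also have "\<dots> = Bz\<^sup>2 / lam" using lambda_pos by (simp add: power_divide)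
    finally show ?case .
  qed
qed

lemma AE_white: "j < q \<Longrightarrow> AE w in P. \<bar>white U j w\<bar> \<le> Bz / sqrt lam"
proof -
  assume j: "j < q"
  show ?thesis
    using AE_white_sq
  proof eventually_elim
    case (elim w)
    have "(white U j w)\<^sup>2 \<le> (\<Sum>j<q. (white U j w)\<^sup>2)"
      using j by (intro member_le_sum) auto
    with elim have "(white U j w)\<^sup>2 \<le> Bz\<^sup>2 / lam" by linarith
    then have "\<bar>white U j w\<bar> \<le> sqrt (Bz\<^sup>2 / lam)"
      using real_sqrt_le_mono by fastforce
    then show ?case using Bz_pos by (simp add: real_sqrt_divide)
  qed
qed

lemma integrable_white_white: "i < q \<Longrightarrow> j < q \<Longrightarrow> integrable P (\<lambda>w. white U i w * white U j w)"
  by (intro integrable_mult_bounded[OF _ _ AE_white AE_white] white_measurable)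

lemma expectation_white_white:
  assumes i: "i < q" and j: "j < q"
  shows "(LINT w|P. white U i w * white U j w) = (if i = j then 1 else 0)"
proof -
  have eq: "white U i w * white U j w = (\<Sum>a<q. \<Sum>b<q. U $$ (a, i) * U $$ (b, j) * (z a w * z b w))" for w
    unfolding white_def sum_product by (simp add: mult_ac)
  have "(LINT w|P. white U i w * white U j w)
      = (\<Sum>a<q. \<Sum>b<q. U $$ (a, i) * U $$ (b, j) * sigma_z q P $$ (a, b))"
    unfolding eq using integrable_zz
    by (subst Bochner_Integration.integral_sum)
      (auto intro!: Bochner_Integration.integrable_sum sum.cong simp: sigma_z_index
        Bochner_Integration.integral_sum)
  also have "\<dots> = (transpose_mat U * (sigma_z q P * U)) $$ (i, j)"
  proof -
    have "(transpose_mat U * (sigma_z q P * U)) $$ (i, j)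
        = (\<Sum>a<q. U $$ (a, i) * (\<Sum>b<q. sigma_z q P $$ (a, b) * U $$ (b, j)))"
      using U sigma_z_carrier i j by (simp add: scalar_prod_real_vec)
    also have "\<dots> = (\<Sum>a<q. \<Sum>b<q. U $$ (a, i) * U $$ (b, j) * sigma_z q P $$ (a, b))"
      by (simp add: sum_distrib_left mult_ac)
    finally show ?thesis by simp
  qed
  also have "transpose_mat U * (sigma_z q P * U) = 1\<^sub>m q"
    using whitens assoc_mult_mat[OF transpose_carrier_mat[THEN iffD2, OF U] sigma_z_carrier U] by simp
  finally show ?thesis using i j by simp
qed

lemma expectation_white_e:
  assumes j: "j < q" and k: "k < p"
  shows "(LINT w|P. white U j w * e k w) = 0"
proof -
  have eq: "white U j w * e k w = (\<Sum>a<q. U $$ (a, j) * (z a w * e k w))" for w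
    unfolding white_def sum_distrib_right by (simp add: mult_ac)
  show ?thesis
    unfolding eq using k by (subst Bochner_Integration.integral_sum) (auto simp: integrable_ze expectation_ze)
qed

lemma expectation_white_sq: "integrable P (\<lambda>w. \<Sum>j<q. (white U j w)\<^sup>2)"
    "(LINT w|P. (\<Sum>j<q. (white U j w)\<^sup>2)) = real q"
proof -
  show "integrable P (\<lambda>w. \<Sum>j<q. (white U j w)\<^sup>2)"
    using integrable_white_white by (auto intro!: Bochner_Integration.integrable_sum simp: power2_eq_square)
  have "(LINT w|P. (\<Sum>j<q. (white U j w)\<^sup>2)) = (\<Sum>j<q. LINT w|P. (white U j w)\<^sup>2)"
    using integrable_white_white by (subst Bochner_Integration.integral_sum) (auto simp: power2_eq_square)
  also have "\<dots> = real q"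
    by (simp add: power2_eq_square expectation_white_white)
  finally show "(LINT w|P. (\<Sum>j<q. (white U j w)\<^sup>2)) = real q" .
qed

text \<open>For one whitened row w the squared Frobenius norm of w w^T - I is |w|^4 - 2 |w|^2 + q.
  With R = Bz^2 / lam, the bound |w|^2 \<le> R and E|w|^2 = q, its mean is at most (R - 1)
  q.\<close>

lemma white_covariance_error:
  defines "\<xi> \<equiv> \<lambda>(j, k) w. white U j w * white U k w - (if j = k then 1 else 0)"
  shows "integrable (sample_law n P) (\<lambda>\<omega>. \<Sum>i\<in>{..<q} \<times> {..<q}. (\<Sum>r<n. \<xi> i (\<omega> r))\<^sup>2)"
    and "(LINT \<omega>|sample_law n P. (\<Sum>i\<in>{..<q} \<times> {..<q}. (\<Sum>r<n. \<xi> i (\<omega> r))\<^sup>2))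
      \<le> real n * (Bz\<^sup>2 / lam * real q)"
proof -
  let ?I = "{..<q} \<times> {..<q}"
  define R where "R = Bz\<^sup>2 / lam"
  have R0: "0 \<le> R" using lambda_pos by (simp add: R_def)
  have meas: "\<xi> i \<in> borel_measurable P" if "i \<in> ?I" for i
    unfolding \<xi>_def by (cases i) simp
  have bdd: "AE w in P. \<bar>\<xi> i w\<bar> \<le> R + 1" if i: "i \<in> ?I" for i
  proof -
    obtain j k where jk: "i = (j, k)" "j < q" "k < q" using i by auto
    show ?thesis
      using AE_white[OF jk(2)] AE_white[OF jk(3)]
    proof eventually_elim
      case (elim w)
      have "\<bar>white U j w * white U k w\<bar> \<le> Bz / sqrt lam * (Bz / sqrt lam)"
        unfolding abs_mult using elim by (intro mult_mono') auto
      also have "\<dots> = R" using lambda_pos by (simp add: R_def power2_eq_square)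
      finally have "\<bar>white U j w * white U k w\<bar> \<le> R" .
      then show ?case
        using abs_triangle_ineq4[of "white U j w * white U k w" "if j = k then 1 else 0"]
        unfolding \<xi>_def jk(1) prod.case by (smt (verit))
    qed
  qed
  have cent: "(LINT w|P. \<xi> i w) = 0" if i: "i \<in> ?I" for i
  proof -
    obtain j k where jk: "i = (j, k)" "j < q" "k < q" using i by auto
    show ?thesis
      unfolding \<xi>_def jk(1) using integrable_white_white[OF jk(2,3)] expectation_white_white[OF jk(2,3)]
      by (simp add: P.prob_space)
  qed
  note mom = sum_squares_moments[where P = P and I = ?I and \<xi> = \<xi> and n = n, OF prob_P _ meas bdd cent]
  show "integrable (sample_law n P) (\<lambda>\<omega>. \<Sum>i\<in>?I. (\<Sum>r<n. \<xi> i (\<omega> r))\<^sup>2)"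
    unfolding sample_law_def by (rule mom(1)) auto
  have sum_sq: "(\<Sum>i\<in>?I. (\<xi> i w)\<^sup>2)
      = (\<Sum>j<q. (white U j w)\<^sup>2)\<^sup>2 - 2 * (\<Sum>j<q. (white U j w)\<^sup>2) + real q" for w
  proof -
    have "(\<Sum>i\<in>?I. (\<xi> i w)\<^sup>2) = (\<Sum>j<q. \<Sum>k<q. (white U j w)\<^sup>2 * (white U k w)\<^sup>2
        + (if j = k then 1 - 2 * (white U j w)\<^sup>2 else 0))"
      unfolding \<xi>_def sum.cartesian_product
      by (intro sum.cong) (auto simp: power2_eq_square algebra_simps)
    also have "\<dots> = (\<Sum>j<q. \<Sum>k<q. (white U j w)\<^sup>2 * (white U k w)\<^sup>2) + (\<Sum>j<q. 1 - 2 * (white U j w)\<^sup>2)"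
      by (simp add: sum.distrib)
    finally show ?thesis
      by (simp add: sum_product[symmetric] power2_eq_square sum_subtractf sum_distrib_left)
  qed
  \<comment> \<open>\<open>R - 2\<close> may have either sign; the mean of the sum it multiplies is
    known exactly, so this does no harm.\<close>
  have "(LINT w|P. (\<Sum>i\<in>?I. (\<xi> i w)\<^sup>2)) \<le> (LINT w|P. (R - 2) * (\<Sum>j<q. (white U j w)\<^sup>2) + real q)"
  proof (rule integral_mono_AE')
    show "integrable P (\<lambda>w. (R - 2) * (\<Sum>j<q. (white U j w)\<^sup>2) + real q)"
      using expectation_white_sq(1) by simp
    show le: "AE w in P. (\<Sum>i\<in>?I. (\<xi> i w)\<^sup>2) \<le> (R - 2) * (\<Sum>j<q. (white U j w)\<^sup>2) + real q"
      using AE_white_sq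
    proof eventually_elim
      case (elim w)
      have "(\<Sum>j<q. (white U j w)\<^sup>2) * (\<Sum>j<q. (white U j w)\<^sup>2) \<le> R * (\<Sum>j<q. (white U j w)\<^sup>2)"
        using elim by (intro mult_right_mono) (auto simp: R_def sum_nonneg)
      then show ?case unfolding sum_sq by (simp add: power2_eq_square algebra_simps)
    qed
    have nonneg: "0 \<le> (\<Sum>i\<in>?I. (\<xi> i w)\<^sup>2)" for w by (simp add: sum_nonneg)
    from le show "AE w in P. 0 \<le> (R - 2) * (\<Sum>j<q. (white U j w)\<^sup>2) + real q"
      by eventually_elim (rule order_trans[OF nonneg])
  qed
  also have "\<dots> = (R - 2) * real q + real q"
    using expectation_white_sq by (simp add: P.prob_space)
  also have "\<dots> \<le> R * real q" by (simp add: algebra_simps)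
  finally have "(LINT w|P. (\<Sum>i\<in>?I. (\<xi> i w)\<^sup>2)) \<le> R * real q" .
  then show "(LINT \<omega>|sample_law n P. (\<Sum>i\<in>?I. (\<Sum>r<n. \<xi> i (\<omega> r))\<^sup>2)) \<le> real n * (Bz\<^sup>2 / lam * real q)"
  proof -
    have "(LINT \<omega>|sample_law n P. (\<Sum>i\<in>?I. (\<Sum>r<n. \<xi> i (\<omega> r))\<^sup>2))
        = real n * (LINT w|P. (\<Sum>i\<in>?I. (\<xi> i w)\<^sup>2))"
      unfolding sample_law_def by (rule mom(2)) auto
    then show ?thesis
      using mult_left_mono[OF \<open>(LINT w|P. (\<Sum>i\<in>?I. (\<xi> i w)\<^sup>2)) \<le> R * real q\<close>, of "real n"]
      unfolding R_def by linarith
  qed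
qed

text \<open>The squares of the products w_j \<epsilon>2_k sum to |w|^2 |\<epsilon>2|^2, whose mean
  is at most B\<epsilon>2^2 q and whose second moment is at most B\<epsilon>2^4 (Bz^2 / lam) q. In
  the second moment only one of the two factors |w|^2 is replaced by its almost sure bound; the
  other one is averaged.\<close>

lemma white_noise2_error:
  defines "\<xi> \<equiv> \<lambda>(j, k) w. white U j w * e k w"
  shows "integrable (sample_law n P) (\<lambda>\<omega>. (\<Sum>i\<in>{..<q} \<times> {..<p}. (\<Sum>r<n. \<xi> i (\<omega> r))\<^sup>2)\<^sup>2)"
    and "(LINT \<omega>|sample_law n P. (\<Sum>i\<in>{..<q} \<times> {..<p}. (\<Sum>r<n. \<xi> i (\<omega> r))\<^sup>2)\<^sup>2)
      \<le> 4 * (real n)\<^sup>2 * (B\<epsilon>\<^sub>2\<^sup>2 * real q)\<^sup>2 + 3 * real n * (B\<epsilon>\<^sub>2 ^ 4 * (Bz\<^sup>2 / lam) * real q)"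
proof -
  let ?I = "{..<q} \<times> {..<p}"
  let ?w = "\<lambda>w. \<Sum>j<q. (white U j w)\<^sup>2" and ?e = "\<lambda>w. \<Sum>k<p. (e k w)\<^sup>2"
  define R where "R = Bz\<^sup>2 / lam"
  have R0: "0 \<le> R" using lambda_pos by (simp add: R_def)
  have meas: "\<xi> i \<in> borel_measurable P" if "i \<in> ?I" for i
  proof -
    obtain j k where jk: "i = (j, k)" "k < p" using \<open>i \<in> ?I\<close> by auto
    show ?thesis unfolding \<xi>_def jk(1) using e_measurable[OF jk(2)] by simp
  qed
  have bdd: "AE w in P. \<bar>\<xi> i w\<bar> \<le> Bz / sqrt lam * B\<epsilon>\<^sub>2" if i: "i \<in> ?I" for i
  proof -
    obtain j k where jk: "i = (j, k)" "j < q" "k < p" using i by auto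
    show ?thesis
      using AE_white[OF jk(2)] AE_e[OF jk(3)]
      by eventually_elim (unfold \<xi>_def jk(1) prod.case abs_mult, rule mult_mono', auto)
  qed
  have cent: "(LINT w|P. \<xi> i w) = 0" if i: "i \<in> ?I" for i
    using i expectation_white_e by (auto simp: \<xi>_def)
  have sum_sq: "(\<Sum>i\<in>?I. (\<xi> i w)\<^sup>2) = ?w w * ?e w" for w
    by (simp add: \<xi>_def sum_product sum.cartesian_product power_mult_distrib case_prod_unfold)
  have nonneg: "0 \<le> ?w w" "0 \<le> ?e w" for w by (simp_all add: sum_nonneg)
  note mom = sum_squares_moments[where P = P and I = ?I and \<xi> = \<xi> and n = n, OF prob_P _ meas bdd cent]
  show "integrable (sample_law n P) (\<lambda>\<omega>. (\<Sum>i\<in>?I. (\<Sum>r<n. \<xi> i (\<omega> r))\<^sup>2)\<^sup>2)"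
    unfolding sample_law_def by (rule mom(3)) auto
  have "(LINT w|P. (\<Sum>i\<in>?I. (\<xi> i w)\<^sup>2)) \<le> (LINT w|P. B\<epsilon>\<^sub>2\<^sup>2 * ?w w)"
  proof (rule integral_mono_AE')
    show "AE w in P. (\<Sum>i\<in>?I. (\<xi> i w)\<^sup>2) \<le> B\<epsilon>\<^sub>2\<^sup>2 * ?w w"
      using AE_e_sq
    proof eventually_elim
      case (elim w)
      show ?case
        unfolding sum_sq using mult_left_mono[OF elim nonneg(1), of w] by (simp only: mult_ac)
    qed
  qed (use expectation_white_sq(1) nonneg in auto)
  then have v: "(LINT w|P. (\<Sum>i\<in>?I. (\<xi> i w)\<^sup>2)) \<le> B\<epsilon>\<^sub>2\<^sup>2 * real q"
    using expectation_white_sq by simp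
  have "(LINT w|P. (\<Sum>i\<in>?I. (\<xi> i w)\<^sup>2)\<^sup>2) \<le> (LINT w|P. B\<epsilon>\<^sub>2 ^ 4 * R * ?w w)"
  proof (rule integral_mono_AE')
    show "AE w in P. (\<Sum>i\<in>?I. (\<xi> i w)\<^sup>2)\<^sup>2 \<le> B\<epsilon>\<^sub>2 ^ 4 * R * ?w w"
      using AE_e_sq AE_white_sq
    proof eventually_elim
      case (elim w)
      have "(?w w)\<^sup>2 \<le> R * ?w w"
        using mult_right_mono[OF elim(2) nonneg(1)[of w]]
        unfolding power2_eq_square[of "?w w"] R_def .
      moreover have "(?e w)\<^sup>2 \<le> (B\<epsilon>\<^sub>2\<^sup>2)\<^sup>2"
        by (rule power_mono[OF elim(1) nonneg(2)])
      ultimately have "(?w w)\<^sup>2 * (?e w)\<^sup>2 \<le> (R * ?w w) * (B\<epsilon>\<^sub>2\<^sup>2)\<^sup>2"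
        using R0 nonneg by (intro mult_mono) auto
      then show ?case
        unfolding sum_sq by (simp add: power_mult_distrib mult_ac flip: power_mult)
    qed
  qed (use expectation_white_sq(1) nonneg R0 in auto)
  then have m: "(LINT w|P. (\<Sum>i\<in>?I. (\<xi> i w)\<^sup>2)\<^sup>2) \<le> B\<epsilon>\<^sub>2 ^ 4 * R * real q"
    using expectation_white_sq by simp
  have "(LINT \<omega>|sample_law n P. (\<Sum>i\<in>?I. (\<Sum>r<n. \<xi> i (\<omega> r))\<^sup>2)\<^sup>2)
      \<le> 4 * (real n)\<^sup>2 * (LINT w|P. (\<Sum>i\<in>?I. (\<xi> i w)\<^sup>2))\<^sup>2
        + 3 * real n * (LINT w|P. (\<Sum>i\<in>?I. (\<xi> i w)\<^sup>2)\<^sup>2)"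
    unfolding sample_law_def by (rule mom(4)) auto
  also have "\<dots> \<le> 4 * (real n)\<^sup>2 * (B\<epsilon>\<^sub>2\<^sup>2 * real q)\<^sup>2 + 3 * real n * (B\<epsilon>\<^sub>2 ^ 4 * R * real q)"
    using v m by (intro add_mono mult_left_mono power_mono) (auto simp: sum_nonneg)
  finally show "(LINT \<omega>|sample_law n P. (\<Sum>i\<in>?I. (\<Sum>r<n. \<xi> i (\<omega> r))\<^sup>2)\<^sup>2)
      \<le> 4 * (real n)\<^sup>2 * (B\<epsilon>\<^sub>2\<^sup>2 * real q)\<^sup>2 + 3 * real n * (B\<epsilon>\<^sub>2 ^ 4 * (Bz\<^sup>2 / lam) * real q)"
    by (simp add: R_def)
qed

end

text \<open>The instrument stays unwhitened here because the deterministic error bound is stated in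
  terms of Z^T \<epsilon>1. The first noise enters the estimate through its variance; its almost
  sure bound provides integrability.\<close>

lemma instrument_noise1_error:
  shows "integrable (sample_law n P) (\<lambda>\<omega>. \<Sum>j<q. (\<Sum>r<n. z j (\<omega> r) * noise1 (\<omega> r))\<^sup>2)"
    and "(LINT \<omega>|sample_law n P. (\<Sum>j<q. (\<Sum>r<n. z j (\<omega> r) * noise1 (\<omega> r))\<^sup>2))
      \<le> real n * (Bz\<^sup>2 * \<sigma>\<^sub>1\<^sup>2)"
proof -
  have meas: "(\<lambda>w. z j w * noise1 w) \<in> borel_measurable P" if "j \<in> {..<q}" for j
    using that by (intro borel_measurable_times z_measurable noise1_measurable) auto
  have bdd: "AE w in P. \<bar>z j w * noise1 w\<bar> \<le> Bz * B\<epsilon>\<^sub>1" if j: "j \<in> {..<q}" for j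
    using AE_z[of j] j AE_noise1 by (auto simp: abs_mult elim: eventually_elim2 intro!: mult_mono')
  have cent: "(LINT w|P. z j w * noise1 w) = 0" if "j \<in> {..<q}" for j
    using that expectation_z_noise1 by auto
  note mom = sum_squares_moments[where P = P and I = "{..<q}" and \<xi> = "\<lambda>j w. z j w * noise1 w"
    and n = n, OF prob_P _ meas bdd cent]
  show "integrable (sample_law n P) (\<lambda>\<omega>. \<Sum>j<q. (\<Sum>r<n. z j (\<omega> r) * noise1 (\<omega> r))\<^sup>2)"
    unfolding sample_law_def by (rule mom(1)) auto
  have "(LINT w|P. (\<Sum>j<q. (z j w * noise1 w)\<^sup>2)) \<le> (LINT w|P. Bz\<^sup>2 * (noise1 w)\<^sup>2)"
  proof (rule integral_mono_AE')
    show "AE w in P. (\<Sum>j<q. (z j w * noise1 w)\<^sup>2) \<le> Bz\<^sup>2 * (noise1 w)\<^sup>2"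
      using AE_z_sq
    proof eventually_elim
      case (elim w)
      show ?case
        using mult_right_mono[OF elim zero_le_power2[of "noise1 w"]]
        by (simp add: power_mult_distrib sum_distrib_right)
    qed
  qed (use integrable_noise1_sq in auto)
  then have le: "(LINT w|P. (\<Sum>j<q. (z j w * noise1 w)\<^sup>2)) \<le> Bz\<^sup>2 * \<sigma>\<^sub>1\<^sup>2"
    using expectation_noise1_sq by simp
  have "(LINT \<omega>|sample_law n P. (\<Sum>j<q. (\<Sum>r<n. z j (\<omega> r) * noise1 (\<omega> r))\<^sup>2))
      = real n * (LINT w|P. (\<Sum>j<q. (z j w * noise1 w)\<^sup>2))"
    unfolding sample_law_def by (rule mom(2)) auto
  then show "(LINT \<omega>|sample_law n P. (\<Sum>j<q. (\<Sum>r<n. z j (\<omega> r) * noise1 (\<omega> r))\<^sup>2))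
      \<le> real n * (Bz\<^sup>2 * \<sigma>\<^sub>1\<^sup>2)"
    using mult_left_mono[OF le, of "real n"] by linarith
qed

section \<open>The expected clipped loss\<close>

definition noise1_data :: "(nat \<Rightarrow> obs) \<Rightarrow> real vec" where
  "noise1_data \<omega> = vec n (\<lambda>r. noise1 (\<omega> r))"

definition noise2_data :: "(nat \<Rightarrow> obs) \<Rightarrow> real mat" where
  "noise2_data \<omega> = mat n p (\<lambda>(r, k). e k (\<omega> r))"

definition loss :: "(nat \<Rightarrow> obs) \<Rightarrow> real" where
  "loss \<omega> = (vnorm (clip B\<beta> (beta_2sls (data_Z n q \<omega>) (data_X n p q \<Theta> \<omega>) (data_Y n p q \<beta> \<Theta> \<omega>))
                  - \<beta>))\<^sup>2"

section \<open>Data matrices expressed through single observations\<close>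

lemma data_Z_carrier: "data_Z n q \<omega> \<in> carrier_mat n q"
  by (simp add: data_Z_def mat_of_rows_def)

lemma data_Z_index: "r < n \<Longrightarrow> j < q \<Longrightarrow> data_Z n q \<omega> $$ (r, j) = z j (\<omega> r)"
  by (simp add: data_Z_def mat_of_rows_def instrument_def)

lemma data_X_carrier: "data_X n p q \<Theta> \<omega> \<in> carrier_mat n p"
  by (simp add: data_X_def mat_of_rows_def)

lemma data_X_eq: "data_X n p q \<Theta> \<omega> = data_Z n q \<omega> * \<Theta> + noise2_data \<omega>"
proof (rule eq_matI)
  fix r k
  assume "r < dim_row (data_Z n q \<omega> * \<Theta> + noise2_data \<omega>)"
    "k < dim_col (data_Z n q \<omega> * \<Theta> + noise2_data \<omega>)"
  then have rk: "r < n" "k < p" by (auto simp: noise2_data_def)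
  have row: "row (data_Z n q \<omega>) r = instrument q (\<omega> r)"
    using rk by (simp add: data_Z_def instrument_def)
  have "(data_Z n q \<omega> * \<Theta>) $$ (r, k) = instrument q (\<omega> r) \<bullet> col \<Theta> k"
    using rk data_Z_carrier[of \<omega>] carrier_\<Theta> by (simp add: row)
  also have "\<dots> = col \<Theta> k \<bullet> instrument q (\<omega> r)"
    using rk carrier_\<Theta> by (intro comm_scalar_prod[of _ q]) (auto simp: instrument_def)
  finally have "(data_Z n q \<omega> * \<Theta>) $$ (r, k) + e k (\<omega> r) = regressor p q \<Theta> (\<omega> r) $ k"
    by (simp add: regressor_index[OF rk(2)])
  then show "data_X n p q \<Theta> \<omega> $$ (r, k) = (data_Z n q \<omega> * \<Theta> + noise2_data \<omega>) $$ (r, k)"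
    using rk data_Z_carrier[of \<omega>] carrier_\<Theta>
    by (simp add: noise2_data_def data_X_def mat_of_rows_def)
qed (simp_all add: data_X_def noise2_data_def)

lemma data_Y_eq: "data_Y n p q \<beta> \<Theta> \<omega> = data_X n p q \<Theta> \<omega> *\<^sub>v \<beta> + noise1_data \<omega>"
proof (rule eq_vecI)
  fix r
  assume "r < dim_vec (data_X n p q \<Theta> \<omega> *\<^sub>v \<beta> + noise1_data \<omega>)"
  then have r: "r < n" by (simp add: noise1_data_def)
  have reg: "regressor p q \<Theta> (\<omega> r) \<in> carrier_vec p"
    using mult_mat_vec_carrier[OF transpose_carrier_mat[THEN iffD2, OF carrier_\<Theta>], of "instrument q (\<omega> r)"]
    by (auto simp: regressor_def noise2_def instrument_def intro!: add_carrier_vec)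
  have "row (data_X n p q \<Theta> \<omega>) r = regressor p q \<Theta> (\<omega> r)"
    using r reg by (simp add: data_X_def)
  then show "data_Y n p q \<beta> \<Theta> \<omega> $ r = (data_X n p q \<Theta> \<omega> *\<^sub>v \<beta> + noise1_data \<omega>) $ r"
    using r data_X_carrier[of \<omega>] comm_scalar_prod[OF carrier_\<beta> reg]
    by (simp add: data_Y_def response_def noise1_data_def)
qed (simp_all add: data_Y_def noise1_data_def)

lemma transpose_Z_noise1:
  "(vnorm (transpose_mat (data_Z n q \<omega>) *\<^sub>v noise1_data \<omega>))\<^sup>2
    = (\<Sum>j<q. (\<Sum>r<n. z j (\<omega> r) * noise1 (\<omega> r))\<^sup>2)"
proof -
  have "(transpose_mat (data_Z n q \<omega>) *\<^sub>v noise1_data \<omega>) $ j = (\<Sum>r<n. z j (\<omega> r) * noise1 (\<omega> r))"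
    if "j < q" for j
    using that data_Z_carrier[of \<omega>] by (simp add: scalar_prod_real_vec noise1_data_def data_Z_index)
  then show ?thesis
    unfolding vnorm_power2 scalar_prod_real_vec[of _ "transpose_mat (data_Z n q \<omega>) *\<^sub>v noise1_data \<omega>"]
    using data_Z_carrier[of \<omega>] by (simp add: power2_eq_square)
qed

context
  fixes U :: "real mat" assumes U: "U \<in> carrier_mat q q"
begin

lemma white_data_carrier: "data_Z n q \<omega> * U \<in> carrier_mat n q"
  by (rule mult_carrier_mat[OF data_Z_carrier U])

lemma white_data_index: "r < n \<Longrightarrow> j < q \<Longrightarrow> (data_Z n q \<omega> * U) $$ (r, j) = white U j (\<omega> r)"
  using U data_Z_carrier[of \<omega>]
  by (simp add: white_def scalar_prod_real_vec data_Z_index mult.commute)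

text \<open>The \<open>case\<close> expression is the family \<open>\<xi>\<close> of
  \<open>white_covariance_error\<close> verbatim, so that the moment bound can be folded into one on
  the Frobenius norm. The companion for the second noise has the same form for the same
  reason.\<close>

lemma frobenius_white_gram:
  "frobenius_sq (transpose_mat (data_Z n q \<omega> * U) * (data_Z n q \<omega> * U) - real n \<cdot>\<^sub>m 1\<^sub>m q)
    = (\<Sum>i\<in>{..<q} \<times> {..<q}. (\<Sum>r<n. (case i of (j, k) \<Rightarrow>
        \<lambda>w. white U j w * white U k w - (if j = k then 1 else 0)) (\<omega> r))\<^sup>2)"
proof -
  let ?W = "data_Z n q \<omega> * U"
  let ?D = "transpose_mat ?W * ?W - real n \<cdot>\<^sub>m 1\<^sub>m q"
  note W = white_data_carrier[of \<omega>]
  have "?D $$ (j, k) = (\<Sum>r<n. white U j (\<omega> r) * white U k (\<omega> r) - (if j = k then 1 else 0))"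
    if "j < q" "k < q" for j k
  proof -
    have "(transpose_mat ?W * ?W) $$ (j, k) = col ?W j \<bullet> col ?W k"
      by (subst index_mult_mat(1)) (use that U data_Z_carrier[of \<omega>] in auto)
    also have "\<dots> = (\<Sum>r<n. white U j (\<omega> r) * white U k (\<omega> r))"
      unfolding scalar_prod_real_vec using that W
      by (intro sum.cong) (auto simp: white_data_index simp del: index_mult_mat)
    finally show ?thesis
      using that W by (simp add: sum_subtractf del: index_mult_mat(1))
  qed
  moreover have "dim_row ?D = q" "dim_col ?D = q" by auto
  ultimately show ?thesis
    unfolding frobenius_sq_def by (simp add: sum.cartesian_product case_prod_unfold)
qed

lemma frobenius_white_noise2:
  "frobenius_sq (transpose_mat (data_Z n q \<omega> * U) * noise2_data \<omega>)
    = (\<Sum>i\<in>{..<q} \<times> {..<p}. (\<Sum>r<n. (case i of (j, k) \<Rightarrow>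
        \<lambda>w. white U j w * e k w) (\<omega> r))\<^sup>2)"
proof -
  let ?W = "data_Z n q \<omega> * U"
  let ?M = "transpose_mat ?W * noise2_data \<omega>"
  note W = white_data_carrier[of \<omega>]
  have E: "noise2_data \<omega> \<in> carrier_mat n p" by (simp add: noise2_data_def)
  have "?M $$ (j, k) = (\<Sum>r<n. white U j (\<omega> r) * e k (\<omega> r))" if "j < q" "k < p" for j k
  proof -
    have "?M $$ (j, k) = col ?W j \<bullet> col (noise2_data \<omega>) k"
      by (subst index_mult_mat(1)) (use that U E data_Z_carrier[of \<omega>] in auto)
    also have "\<dots> = (\<Sum>r<n. white U j (\<omega> r) * e k (\<omega> r))"
      unfolding scalar_prod_real_vec using that W E
      by (intro sum.cong) (auto simp: white_data_index noise2_data_def simp del: index_mult_mat)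
    finally show ?thesis .
  qed
  moreover have "dim_row ?M = q" "dim_col ?M = p" using W E by auto
  ultimately show ?thesis
    unfolding frobenius_sq_def by (simp add: sum.cartesian_product case_prod_unfold)
qed

end

section \<open>Bounds on the loss and its expectation\<close>

lemma vnorm_beta_le: "vnorm \<beta> \<le> B\<beta>"
  using reg by (simp add: regularity_def)

text \<open>Testing on a unit vector, which exists because \<open>p > 0\<close>. This is what makes
  the numerator \<open>B\<Theta> + dev\<close> of C(n) large enough to be compared with
  \<open>sig\<close>.\<close>

lemma sigma_min_le_bound: "sig \<le> B\<Theta>"
proof -
  let ?u = "unit_vec p 0 :: real vec"
  have u: "?u \<in> carrier_vec p" "vnorm ?u = 1"
    using iv_assumption_dims(1)[OF iv] by (auto simp: vnorm_def)
  have "sig \<le> vnorm (\<Theta> *\<^sub>v ?u)"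
    using sigma_min_le[OF carrier_\<Theta> u(1) sigma_pos] u(2) by simp
  also have "\<dots> \<le> spectral_norm \<Theta>"
    using spectral_norm_ge[OF carrier_\<Theta> u(1)] u(2) by simp
  also have "\<dots> \<le> B\<Theta>" using reg by (simp add: regularity_def)
  finally show ?thesis .
qed

lemma loss_le_bound:
  assumes "beta_2sls (data_Z n q \<omega>) (data_X n p q \<Theta> \<omega>) (data_Y n p q \<beta> \<Theta> \<omega>) \<in> carrier_vec p"
  shows "loss \<omega> \<le> 4 * B\<beta>\<^sup>2"
proof -
  have "loss \<omega> \<le> (2 * B\<beta>)\<^sup>2"
    unfolding loss_def by (rule power_mono[OF clip_minus_le_bound[OF assms carrier_\<beta> vnorm_beta_le]]) simp
  then show ?thesis by (simp add: power_mult_distrib)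
qed

lemma beta_2sls_carrier:
  assumes inv: "invertible_mat (second_stage_gram (data_Z n q \<omega>) (data_X n p q \<Theta> \<omega>))"
  shows "beta_2sls (data_Z n q \<omega>) (data_X n p q \<Theta> \<omega>) Y \<in> carrier_vec p"
proof -
  let ?H = "second_stage_gram (data_Z n q \<omega>) (data_X n p q \<Theta> \<omega>)"
  have "?H \<in> carrier_mat p p"
    using data_X_carrier[of \<omega>] by (auto simp: second_stage_gram_def theta_hat_def)
  then have "mat_inv ?H \<in> carrier_mat p p"
    using mat_inv_invertible(1) inv by blast
  then show ?thesis by (auto simp: beta_2sls_def intro!: carrier_vecI)
qed

text \<open>On the event that one of the two Frobenius norms is too large for
  \<open>second_stage_error_bound\<close>, clipping bounds the loss and Markov's inequality, applied pointwise,
  bounds the indicator of the event.\<close>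
lemma expected_loss_le:
  "(LINT \<omega>|sample_law n P. loss \<omega>)
    \<le> 4 * B\<beta>\<^sup>2 * (4 / (real n)\<^sup>2 * (real n * (Bz\<^sup>2 / lam * real q))
        + 256 / ((real n) ^ 4 * lam\<^sup>2 * sig ^ 4)
          * (4 * (real n)\<^sup>2 * (B\<epsilon>\<^sub>2\<^sup>2 * real q)\<^sup>2 + 3 * real n * (B\<epsilon>\<^sub>2 ^ 4 * (Bz\<^sup>2 / lam) * real q)))
      + 16 / ((real n)\<^sup>2 * lam\<^sup>2 * sig\<^sup>2) * (real n * (Bz\<^sup>2 * \<sigma>\<^sub>1\<^sup>2))"
proof -
  obtain U V where U: "U \<in> carrier_mat q q" and V: "V \<in> carrier_mat q q" and UV: "U * V = 1\<^sub>m q"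
    and whitens: "transpose_mat U * sigma_z q P * U = 1\<^sub>m q"
    and Ub: "\<And>v. v \<in> carrier_vec q \<Longrightarrow> vnorm (U *\<^sub>v v) \<le> vnorm v / sqrt lam"
    and Utb: "\<And>v. v \<in> carrier_vec q \<Longrightarrow> vnorm (transpose_mat U *\<^sub>v v) \<le> vnorm v / sqrt lam"
    by (rule whitening) blast
  let ?Z = "data_Z n q"
  define A where "A \<omega> = frobenius_sq
    (transpose_mat (?Z \<omega> * U) * (?Z \<omega> * U) - real n \<cdot>\<^sub>m 1\<^sub>m q)" for \<omega>
  define M where "M \<omega> = frobenius_sq (transpose_mat (?Z \<omega> * U) * noise2_data \<omega>)" for \<omega>
  define N where "N \<omega> = (vnorm (transpose_mat (?Z \<omega>) *\<^sub>v noise1_data \<omega>))\<^sup>2" for \<omega>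
  note EA = white_covariance_error[OF U whitens Utb, folded frobenius_white_gram[OF U] A_def]
  note EM = white_noise2_error[OF U whitens Utb, folded frobenius_white_noise2[OF U] M_def]
  note EN = instrument_noise1_error[folded transpose_Z_noise1 N_def]
  \<comment> \<open>The first two factors are scaled so that \<open>c1 * A \<omega> \<le> 1\<close>
    and \<open>c2 * (M \<omega>)\<^sup>2 \<le> 1\<close> are exactly the two hypotheses of
    \<open>second_stage_error_bound\<close>; \<open>c3\<close> is the square of its factor 4 / (n
    lam sig).\<close>
  define c1 where "c1 = 4 / (real n)\<^sup>2"
  define c2 where "c2 = 256 / ((real n) ^ 4 * lam\<^sup>2 * sig ^ 4)"
  define c3 where "c3 = 16 / ((real n)\<^sup>2 * lam\<^sup>2 * sig\<^sup>2)"
  have c: "0 \<le> c1" "0 \<le> c2" "0 \<le> c3"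
    using lambda_pos sigma_pos by (auto simp: c1_def c2_def c3_def)
  have A0: "0 \<le> A \<omega>" and M0: "0 \<le> M \<omega>" and N0: "0 \<le> N \<omega>" for \<omega>
    by (simp_all add: A_def M_def N_def)
  define g where "g = (\<lambda>\<omega>. 4 * B\<beta>\<^sup>2 * (c1 * A \<omega> + c2 * (M \<omega>)\<^sup>2) + c3 * N \<omega>)"
  have g0: "0 \<le> g \<omega>" for \<omega>
    using c A0 N0 by (simp add: g_def)
  have g_int: "integrable (sample_law n P) g"
    unfolding g_def using EA(1) EM(1) EN(1) by simp
  have "AE \<omega> in sample_law n P. invertible_mat (transpose_mat (?Z \<omega>) * ?Z \<omega>)
      \<and> invertible_mat (second_stage_gram (?Z \<omega>) (data_X n p q \<Theta> \<omega>))"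
    using iv unfolding iv_assumption_def Let_def by (auto elim: eventually_mono)
  then have le: "AE \<omega> in sample_law n P. loss \<omega> \<le> g \<omega>"
  proof eventually_elim
    case (elim \<omega>)
    let ?b = "beta_2sls (?Z \<omega>) (data_X n p q \<Theta> \<omega>) (data_Y n p q \<beta> \<Theta> \<omega>)"
    have b: "?b \<in> carrier_vec p" by (rule beta_2sls_carrier[OF conjunct2[OF elim]])
    have n1: "noise1_data \<omega> \<in> carrier_vec n" and n2: "noise2_data \<omega> \<in> carrier_mat n p"
      by (simp_all add: noise1_data_def noise2_data_def)
    show ?case
    proof (cases "c1 * A \<omega> \<le> 1 \<and> c2 * (M \<omega>)\<^sup>2 \<le> 1")
      case True
      have nn: "real n > 0" using n_pos by simp
      have "A \<omega> \<le> (real n / 2)\<^sup>2"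
        using True nn by (simp add: c1_def field_simps power2_eq_square)
      moreover have "M \<omega> \<le> (real n * sqrt lam * sig / 4)\<^sup>2"
      proof (rule power2_le_imp_le)
        have "((real n * sqrt lam * sig / 4)\<^sup>2)\<^sup>2 = real n ^ 4 * lam\<^sup>2 * sig ^ 4 / 256"
          using lambda_pos by (simp add: power_mult_distrib power_divide flip: power_mult)
        also have "(M \<omega>)\<^sup>2 \<le> \<dots>"
          using True nn lambda_pos sigma_pos by (simp add: c2_def field_simps)
        finally show "(M \<omega>)\<^sup>2 \<le> ((real n * sqrt lam * sig / 4)\<^sup>2)\<^sup>2" .
      qed simp
      ultimately have "vnorm (?b - \<beta>) \<le> 4 * vnorm (transpose_mat (?Z \<omega>) *\<^sub>v noise1_data \<omega>)
          / (real n * lam * sig)"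
        unfolding A_def M_def
        by (intro second_stage_error_bound[OF data_Z_carrier n2 carrier_\<Theta> carrier_\<beta> n1 U V
              data_X_eq data_Y_eq n_pos lambda_pos sigma_pos UV Ub
              sigma_min_le[OF carrier_\<Theta> _ sigma_pos]] conjunct1[OF elim] conjunct2[OF elim])
      then have "vnorm (clip B\<beta> ?b - \<beta>) \<le> 4 * vnorm (transpose_mat (?Z \<omega>) *\<^sub>v noise1_data \<omega>)
          / (real n * lam * sig)"
        using clip_minus_le[OF b carrier_\<beta> vnorm_beta_le] by linarith
      then have "loss \<omega> \<le> (4 * vnorm (transpose_mat (?Z \<omega>) *\<^sub>v noise1_data \<omega>) / (real n * lam * sig))\<^sup>2"
        unfolding loss_def by (rule power_mono) simp
      also have "\<dots> = c3 * N \<omega>"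
        by (simp add: c3_def N_def power_divide power_mult_distrib)
      also have "\<dots> \<le> g \<omega>"
        using c A0 by (simp add: g_def)
      finally show ?thesis .
    next
      case False
      have "0 \<le> c1 * A \<omega>" "0 \<le> c2 * (M \<omega>)\<^sup>2" using c A0 by auto
      with False have "1 \<le> c1 * A \<omega> + c2 * (M \<omega>)\<^sup>2" by linarith
      then have "4 * B\<beta>\<^sup>2 * 1 \<le> 4 * B\<beta>\<^sup>2 * (c1 * A \<omega> + c2 * (M \<omega>)\<^sup>2)"
        by (rule mult_left_mono) simp
      moreover have "loss \<omega> \<le> 4 * B\<beta>\<^sup>2" by (rule loss_le_bound[OF b])
      moreover have "0 \<le> c3 * N \<omega>" using c N0 by simp
      ultimately show ?thesis unfolding g_def by simp
    qed
  qed
  \<comment> \<open>Integrability is required of the majorant \<open>g\<close> alone: a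
    non-integrable \<open>loss\<close> would have integral 0, which the nonnegativity of
    \<open>g\<close> covers.\<close>
  have "(LINT \<omega>|sample_law n P. loss \<omega>) \<le> (LINT \<omega>|sample_law n P. g \<omega>)"
    by (rule integral_mono_AE'[OF g_int le]) (simp add: g0)
  also have "\<dots> = 4 * B\<beta>\<^sup>2 * (c1 * (LINT \<omega>|sample_law n P. A \<omega>)
      + c2 * (LINT \<omega>|sample_law n P. (M \<omega>)\<^sup>2)) + c3 * (LINT \<omega>|sample_law n P. N \<omega>)"
    unfolding g_def using EA(1) EM(1) EN(1) by simp
  also have "\<dots> \<le> 4 * B\<beta>\<^sup>2 * (c1 * (real n * (Bz\<^sup>2 / lam * real q))
      + c2 * (4 * (real n)\<^sup>2 * (B\<epsilon>\<^sub>2\<^sup>2 * real q)\<^sup>2 + 3 * real n * (B\<epsilon>\<^sub>2 ^ 4 * (Bz\<^sup>2 / lam) * real q)))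
      + c3 * (real n * (Bz\<^sup>2 * \<sigma>\<^sub>1\<^sup>2))"
    using c EA(2) EM(2) EN(2) by (intro add_mono mult_left_mono) auto
  finally show ?thesis by (simp only: c1_def c2_def c3_def)
qed

text \<open>Serves the boundary case in which the denominator of C(n) vanishes.\<close>

lemma expected_loss_le_bound: "(LINT \<omega>|sample_law n P. loss \<omega>) \<le> 4 * B\<beta>\<^sup>2"
proof -
  have N: "prob_space (sample_law n P)"
    unfolding sample_law_def by (rule prob_space_PiM) (rule prob_P)
  interpret N: prob_space "sample_law n P" by (rule N)
  have "AE \<omega> in sample_law n P. invertible_mat (second_stage_gram (data_Z n q \<omega>) (data_X n p q \<Theta> \<omega>))"
    using iv unfolding iv_assumption_def Let_def by (auto elim: eventually_mono)
  then have "AE \<omega> in sample_law n P. loss \<omega> \<le> 4 * B\<beta>\<^sup>2"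
    by eventually_elim (rule loss_le_bound[OF beta_2sls_carrier])
  then have "(LINT \<omega>|sample_law n P. loss \<omega>) \<le> (LINT \<omega>|sample_law n P. 4 * B\<beta>\<^sup>2)"
    by (intro integral_mono_AE') auto
  then show ?thesis by (simp add: N.prob_space)
qed

end

section \<open>The conditions on the sample size\<close>

text \<open>\<open>x\<close> is the term subtracted from 1 in C(n), with b = c Bz^2. In the unit m =
  n / (4 b^2) the first condition reads q + L - 1/2 \<le> m + 1 + ln m, which is at most 2 m by ln m
  \<le> m - 1, while x^2 \<le> (q + L - 1/2) / (2 m). The second condition gives L \<ge> 3/2 and
  keeps the inner root real.\<close>

lemma covariance_deviation_le_one:
  fixes n q K b :: real
  defines "L \<equiv> ln (K / q * n)"
  defines "x \<equiv> b * (sqrt q + sqrt (L - 1 / 2)) / sqrt n"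
  assumes pos: "0 < n" "1 \<le> q" "0 < K" "0 < b"
    and n1: "4 * b\<^sup>2 * (q + ln (4 * b\<^sup>2 * K / q) - 3 / 2) \<le> n"
    and n2: "q * exp (3 / 2) / K \<le> n"
  shows "0 \<le> x" "x \<le> 1" "x = 1 \<Longrightarrow> L \<le> 3 / 2"
proof -
  have u: "exp (3 / 2) \<le> K / q * n"
    using n2 pos by (simp add: field_simps)
  then have L: "3 / 2 \<le> L"
    unfolding L_def using pos by (subst ln_ge_iff) auto
  define a where "a = 4 * b\<^sup>2"
  define m where "m = n / a"
  have a: "a > 0" using pos by (simp add: a_def)
  have m: "m > 0" using a pos by (simp add: m_def)
  have n: "n = a * m" using a by (simp add: m_def)
  have "L = ln (a * K / q * m)"
    using a by (simp add: L_def n mult_ac)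
  also have "\<dots> = ln (a * K / q) + ln m"
    using a m pos by (subst ln_mult) auto
  finally have "ln (a * K / q) = L - ln m" by simp
  then have "a * (q + (L - ln m) - 3 / 2) \<le> a * m"
    using n1 by (simp add: a_def[symmetric] n)
  then have 1: "q + L - 1 / 2 \<le> m + 1 + ln m"
    using a by (simp add: mult_le_cancel_left)
  have ln_m: "ln m \<le> m - 1" using m by (rule ln_le_minus_one)
  show x0: "0 \<le> x" using pos L by (simp add: x_def)
  have "(sqrt q + sqrt (L - 1 / 2))\<^sup>2 \<le> 2 * (q + L - 1 / 2)"
  proof -
    have "0 \<le> (sqrt q - sqrt (L - 1 / 2))\<^sup>2" by simp
    moreover have "(sqrt q)\<^sup>2 = q" "(sqrt (L - 1 / 2))\<^sup>2 = L - 1 / 2" using pos L by auto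
    ultimately show ?thesis by (simp add: power2_sum power2_diff)
  qed
  moreover have "x\<^sup>2 = (sqrt q + sqrt (L - 1 / 2))\<^sup>2 / (4 * m)"
    using pos m by (simp add: x_def power_divide power_mult_distrib n a_def)
  ultimately have x2: "x\<^sup>2 * (2 * m) \<le> q + L - 1 / 2"
    using m by (simp add: field_simps)
  then have "x\<^sup>2 * (2 * m) \<le> 1 * (2 * m)"
    using 1 ln_m by linarith
  then have "x\<^sup>2 \<le> 1" by (rule mult_right_le_imp_le) (use m in simp)
  then show "x \<le> 1" using power2_le_imp_le[of x 1] by simp
  show "L \<le> 3 / 2" if "x = 1"
  proof -
    have "2 * m \<le> q + L - 1 / 2" using x2 that by simp
    \<comment> \<open>At x = 1 every inequality is tight, and ln m = m - 1 only at m = 1. Then q + L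
      - 1/2 \<le> 2, and q \<ge> 1 leaves L \<le> 3/2.\<close>
    then have "ln m = m - 1" using 1 ln_m by linarith
    then have "m = 1" using m by (intro ln_eq_minus_one)
    then show ?thesis using 1 pos by simp
  qed
qed

text \<open>The tangent bound for \<open>ln\<close> at 1, applied to \<open>s / 2\<close> with
  \<open>s = sqrt u\<close>: the difference ln u - sqrt u is largest at u = 4, that is s =
  2.\<close>

lemma ln_less_sqrt:
  fixes u :: real
  assumes "0 < u"
  shows "ln u < sqrt u"
proof -
  define s where "s = sqrt u"
  have s: "s > 0" "u = s * s" using assms by (auto simp: s_def)
  have "ln (s / 2) \<le> s / 2 - 1" using s by (intro ln_le_minus_one) auto
  then have "ln s - ln 2 \<le> s / 2 - 1" using s by (simp add: ln_div)
  moreover have "ln u = 2 * ln s" using s by (simp add: ln_mult)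
  moreover have "ln (2::real) < 1" using ln_2_less_1 .
  ultimately show ?thesis by (simp add: s_def[symmetric])
qed

text \<open>The radicand equals sig^2 t L for t = p (q + 1) / (K0 n). With u = K n / q the third
  condition is t^2 u \<le> 1, that is t sqrt u \<le> 1, and L = ln u < sqrt u makes the conclusion
  strict.\<close>

lemma deviation_less:
  fixes n p q K B lam sig :: real
  defines "K\<^sub>0 \<equiv> lam * sig\<^sup>2 / (2 * B\<^sup>2)"
  defines "L \<equiv> ln (K / q * n)"
  assumes pos: "0 < n" "0 < p" "0 < q" "0 < K" "0 < lam" "0 < sig" "0 < B" and L: "0 \<le> L"
    and n3: "p\<^sup>2 * (q + 1)\<^sup>2 * K / (q * K\<^sub>0\<^sup>2) \<le> n"
  shows "sqrt (2 * p * (q + 1) * B\<^sup>2 * L / (lam * n)) < sig"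
proof -
  define u where "u = K / q * n"
  define t where "t = p * (q + 1) / (K\<^sub>0 * n)"
  have u: "u > 0" and K0: "K\<^sub>0 > 0" using pos by (auto simp: u_def K\<^sub>0_def)
  have t: "t > 0" using pos K0 by (simp add: t_def)
  have "t\<^sup>2 * u \<le> 1"
  proof -
    have "t\<^sup>2 * u = (p\<^sup>2 * (q + 1)\<^sup>2 * K / (q * K\<^sub>0\<^sup>2)) / n"
      using pos K0 by (simp add: t_def u_def power_divide power_mult_distrib field_simps power2_eq_square)
    also have "\<dots> \<le> 1" using n3 pos by (simp only: divide_le_eq_1_pos)
    finally show ?thesis .
  qed
  then have "(t * sqrt u)\<^sup>2 \<le> 1" using u by (simp add: power_mult_distrib)
  then have ts: "t * sqrt u \<le> 1" using power2_le_imp_le[of "t * sqrt u" 1] by simp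
  have "t * L < t * sqrt u"
    using ln_less_sqrt[OF u] t by (simp add: L_def u_def)
  then have tL: "t * L < 1" using ts by linarith
  have "2 * p * (q + 1) * B\<^sup>2 * L / (lam * n) = sig\<^sup>2 * (t * L)"
    using pos by (simp add: t_def K\<^sub>0_def field_simps power2_eq_square)
  also have "\<dots> < sig\<^sup>2 * 1" using tL pos by (intro mult_strict_left_mono) auto
  finally show ?thesis using pos real_sqrt_less_mono[of _ "sig\<^sup>2"] by fastforce
qed

text \<open>In units of q / (n K), the covariance event contributes 2/3 and the first-stage event 64
  * 5 = 320. The prefactor 4 B\<beta>^2 turns the sum into 3848/3, which is rounded up to
  1300.\<close>

lemma failure_term_le:
  fixes n q K B\<beta> Bz Be lam sig p :: real
  defines "K \<equiv> lam / (6 * Bz\<^sup>2)" and "K\<^sub>0 \<equiv> lam * sig\<^sup>2 / (2 * Be\<^sup>2)"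
  assumes pos: "0 < n" "1 \<le> p" "1 \<le> q" "0 < lam" "0 < sig" "0 < Bz" "0 < Be"
    and n2: "q * exp (3 / 2) / K \<le> n"
    and n3: "p\<^sup>2 * (q + 1)\<^sup>2 * K / (q * K\<^sub>0\<^sup>2) \<le> n"
  shows "4 * B\<beta>\<^sup>2 * (4 / n\<^sup>2 * (n * (Bz\<^sup>2 / lam * q))
        + 256 / (n ^ 4 * lam\<^sup>2 * sig ^ 4)
          * (4 * n\<^sup>2 * (Be\<^sup>2 * q)\<^sup>2 + 3 * n * (Be ^ 4 * (Bz\<^sup>2 / lam) * q)))
    \<le> 1300 * (q / n) * (B\<beta>\<^sup>2 / K)"
proof -
  have K: "K > 0" and K0: "K\<^sub>0 > 0" using pos by (auto simp: K_def K\<^sub>0_def)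
  have R: "Bz\<^sup>2 / lam = 1 / (6 * K)" using pos by (simp add: K_def)
  have Be: "Be ^ 4 / (lam\<^sup>2 * sig ^ 4) = 1 / (4 * K\<^sub>0\<^sup>2)"
    using pos by (simp add: K\<^sub>0_def power_divide power_mult_distrib field_simps flip: power_mult)
  \<comment> \<open>Makes the fourth-moment summand that is linear in \<open>n\<close> no larger
    than n^2 q^2, so that 4 becomes 5 below.\<close>
  have Kn: "1 \<le> K * n"
  proof -
    have "1 * 1 \<le> q * exp (3 / 2)" using pos by (intro mult_mono) auto
    then show ?thesis using n2 K by (simp add: field_simps)
  qed
  \<comment> \<open>The third condition weakened by p^2 (q + 1)^2 \<ge> q^2 reads q K / K0^2 \<le>
    n; this exchanges K0 for K at the price of one factor q / n.\<close>
  have K0n: "q\<^sup>2 / (n\<^sup>2 * K\<^sub>0\<^sup>2) \<le> q / (n * K)"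
  proof -
    have "q\<^sup>2 * K / (q * K\<^sub>0\<^sup>2) \<le> p\<^sup>2 * (q + 1)\<^sup>2 * K / (q * K\<^sub>0\<^sup>2)"
    proof -
      have "1 * q\<^sup>2 \<le> p\<^sup>2 * (q + 1)\<^sup>2"
        using pos by (intro mult_mono power_mono) (auto simp: one_le_power)
      then show ?thesis using K K0 pos by (intro divide_right_mono mult_right_mono) auto
    qed
    then have "q * K / K\<^sub>0\<^sup>2 \<le> n" using n3 pos K0 by (simp add: power2_eq_square)
    then have "q * K \<le> n * K\<^sub>0\<^sup>2" using K0 by (simp add: field_simps)
    then have "(q * K) * (q * n) \<le> (n * K\<^sub>0\<^sup>2) * (q * n)" using pos by (intro mult_right_mono) auto
    then show ?thesis using pos K K0 by (simp add: field_simps power2_eq_square)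
  qed
  have "256 / (n ^ 4 * lam\<^sup>2 * sig ^ 4) * (4 * n\<^sup>2 * (Be\<^sup>2 * q)\<^sup>2 + 3 * n * (Be ^ 4 * (Bz\<^sup>2 / lam) * q))
      = 256 / n ^ 4 * (Be ^ 4 / (lam\<^sup>2 * sig ^ 4)) * (4 * n\<^sup>2 * q\<^sup>2 + 3 * n * (Bz\<^sup>2 / lam) * q)"
    by (simp add: power_mult_distrib algebra_simps add_divide_distrib flip: power_mult)
  also have "\<dots> = 64 / (n ^ 4 * K\<^sub>0\<^sup>2) * (4 * n\<^sup>2 * q\<^sup>2 + n * q / (2 * K))"
    unfolding Be R by simp
  also have "\<dots> \<le> 64 / (n ^ 4 * K\<^sub>0\<^sup>2) * (5 * n\<^sup>2 * q\<^sup>2)"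
  proof (rule mult_left_mono)
    have "n * q * 1 \<le> n * q * (q * (n * K) * 2)"
    proof (rule mult_left_mono)
      have "1 * 1 \<le> q * (K * n)" using pos Kn by (intro mult_mono) auto
      then show "1 \<le> q * (n * K) * 2" by (simp add: mult_ac)
    qed (use pos in auto)
    then have "n * q / (2 * K) \<le> n\<^sup>2 * q\<^sup>2"
      using K by (simp add: field_simps power2_eq_square)
    then show "4 * n\<^sup>2 * q\<^sup>2 + n * q / (2 * K) \<le> 5 * n\<^sup>2 * q\<^sup>2" by simp
  qed simp
  also have "\<dots> = 320 * (q\<^sup>2 / (n\<^sup>2 * K\<^sub>0\<^sup>2))"
    using pos K0 by (simp add: field_simps power2_eq_square power4_eq_xxxx)
  also have "\<dots> \<le> 320 * (q / (n * K))"
    using K0n by simp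
  finally have 2: "256 / (n ^ 4 * lam\<^sup>2 * sig ^ 4)
      * (4 * n\<^sup>2 * (Be\<^sup>2 * q)\<^sup>2 + 3 * n * (Be ^ 4 * (Bz\<^sup>2 / lam) * q)) \<le> 320 * (q / (n * K))" .
  have 1: "4 / n\<^sup>2 * (n * (Bz\<^sup>2 / lam * q)) = 2 / 3 * (q / (n * K))"
    unfolding R using pos K by (simp add: field_simps power2_eq_square)
  have "4 * B\<beta>\<^sup>2 * (2 / 3 * (q / (n * K)) + 320 * (q / (n * K))) \<le> 1300 * (q / n) * (B\<beta>\<^sup>2 / K)"
  proof -
    define r where "r = B\<beta>\<^sup>2 * (q / (n * K))"
    have r: "0 \<le> r" using pos K by (simp add: r_def)
    have 3: "4 * B\<beta>\<^sup>2 * (2 / 3 * (q / (n * K)) + 320 * (q / (n * K))) = 3848 / 3 * r"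
      by (simp add: r_def algebra_simps)
    have 4: "1300 * (q / n) * (B\<beta>\<^sup>2 / K) = 1300 * r"
      by (simp add: r_def mult_ac)
    show ?thesis unfolding 3 4 using r by simp
  qed
  moreover have "4 * B\<beta>\<^sup>2 * (4 / n\<^sup>2 * (n * (Bz\<^sup>2 / lam * q))
        + 256 / (n ^ 4 * lam\<^sup>2 * sig ^ 4)
          * (4 * n\<^sup>2 * (Be\<^sup>2 * q)\<^sup>2 + 3 * n * (Be ^ 4 * (Bz\<^sup>2 / lam) * q)))
      \<le> 4 * B\<beta>\<^sup>2 * (2 / 3 * (q / (n * K)) + 320 * (q / (n * K)))"
    unfolding 1 by (intro mult_left_mono add_left_mono 2) simp
  ultimately show ?thesis by linarith
qed

text \<open>Writing Bz / (lam sig) as sig Bz / (lam sig^2), the passage to C(n) only raises the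
  numerator and lowers the denominator. The strict inequalities \<open>x < 1\<close> and
  \<open>dev < sig\<close> keep that denominator positive. The factor \<open>q\<close> on the right
  costs nothing since q \<ge> 1.\<close>

lemma noise_term_le:
  fixes n q Bz B\<Theta> \<sigma> lam sig dev x :: real
  assumes pos: "0 < n" "1 \<le> q" "0 < lam" "0 < sig" "0 < Bz" and B: "sig \<le> B\<Theta>"
    and x: "0 \<le> x" "x < 1" and dev: "0 \<le> dev" "dev < sig"
  shows "16 / (n\<^sup>2 * lam\<^sup>2 * sig\<^sup>2) * (n * (Bz\<^sup>2 * \<sigma>\<^sup>2))
    \<le> 16 * (q / n) * (((B\<Theta> + dev) * Bz / (lam * (1 - x)\<^sup>2 * (sig - dev)\<^sup>2))\<^sup>2 * \<sigma>\<^sup>2)"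
proof -
  let ?C = "(B\<Theta> + dev) * Bz / (lam * (1 - x)\<^sup>2 * (sig - dev)\<^sup>2)"
  have "Bz / (lam * sig) = sig * Bz / (lam * 1 * sig\<^sup>2)"
    using pos by (simp add: power2_eq_square)
  also have "\<dots> \<le> ?C"
  proof (rule frac_le)
    show "lam * (1 - x)\<^sup>2 * (sig - dev)\<^sup>2 \<le> lam * 1 * sig\<^sup>2"
      using x dev pos by (intro mult_mono power_mono) (auto simp: power_le_one)
  qed (use x dev pos B in \<open>auto intro!: mult_right_mono mult_nonneg_nonneg\<close>)
  finally have "(Bz / (lam * sig))\<^sup>2 \<le> ?C\<^sup>2"
    using pos by (intro power_mono) auto
  then have "16 / n * (1 * (Bz / (lam * sig))\<^sup>2) * \<sigma>\<^sup>2 \<le> 16 / n * (q * ?C\<^sup>2) * \<sigma>\<^sup>2"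
    using pos by (intro mult_right_mono mult_left_mono mult_mono) auto
  moreover have "16 / (n\<^sup>2 * lam\<^sup>2 * sig\<^sup>2) * (n * (Bz\<^sup>2 * \<sigma>\<^sup>2))
      = 16 / n * (1 * (Bz / (lam * sig))\<^sup>2) * \<sigma>\<^sup>2"
    using pos by (simp add: field_simps power2_eq_square)
  ultimately show ?thesis by (simp add: mult_ac)
qed

lemma exp_three_halves_le: "exp (3 / 2 :: real) \<le> 9"
proof -
  have "exp (3 / 2 :: real) \<le> exp (1 + 1)" by simp
  also have "\<dots> \<le> 3 * 3"
    unfolding exp_add using exp_le by (intro mult_mono) auto
  finally show ?thesis by simp
qed

theorem theorem2p1:
  shows "\<exists>c>0::real. \<exists>C\<^sub>0>0::real.
    \<forall>(n::nat) (p::nat) (q::nat) (\<beta>::real vec) (\<Theta>::real mat) (\<sigma>\<^sub>1::real) (\<Sigma>\<^sub>2::real mat)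
      (P::obs measure) (B\<beta>::real) (B\<Theta>::real) (Bz::real) (Bx::real) (B\<epsilon>\<^sub>1::real) (B\<epsilon>\<^sub>2::real).
    (let lam = lambda_min (sigma_z q P);
         sig = sigma_min \<Theta>;
         K = lam / (6 * Bz\<^sup>2);
         K\<^sub>0 = lam * sig\<^sup>2 / (2 * B\<epsilon>\<^sub>2\<^sup>2);
         L = ln (K / real q * real n);
         dev = sqrt (2 * real p * (real q + 1) * B\<epsilon>\<^sub>2\<^sup>2 * L / (lam * real n));
         Cn = (B\<Theta> + dev) * Bz /
              (lam * (1 - c * Bz\<^sup>2 * (sqrt (real q) + sqrt (L - 1 / 2)) / sqrt (real n))\<^sup>2
                   * (sig - dev)\<^sup>2)
     in
       linear_model p q \<beta> \<Theta> \<sigma>\<^sub>1 \<Sigma>\<^sub>2 P \<longrightarrow>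
       iv_assumption n p q \<Theta> P \<longrightarrow>
       regularity p q \<beta> \<Theta> P B\<beta> B\<Theta> Bz Bx B\<epsilon>\<^sub>1 B\<epsilon>\<^sub>2 \<longrightarrow>
       0 < lam \<longrightarrow> 0 < sig \<longrightarrow> 0 < Bz \<longrightarrow> 0 < B\<epsilon>\<^sub>2 \<longrightarrow>
       real n \<ge> Max {4 * c\<^sup>2 * Bz ^ 4 * (real q + ln (4 * c\<^sup>2 * Bz ^ 4 * K / real q) - 3 / 2),
                     real q * exp (3 / 2) / K,
                     (real p)\<^sup>2 * (real q + 1)\<^sup>2 * K / (real q * K\<^sub>0\<^sup>2)} \<longrightarrow>
       (LINT \<omega>|sample_law n P.
          (vnorm (clip B\<beta> (beta_2sls (data_Z n q \<omega>) (data_X n p q \<Theta> \<omega>) (data_Y n p q \<beta> \<Theta> \<omega>))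
                  - \<beta>))\<^sup>2)
       \<le> C\<^sub>0 * (real q / real n) * (B\<beta>\<^sup>2 / K + Cn\<^sup>2 * \<sigma>\<^sub>1\<^sup>2))"
proof (rule exI[of _ "1::real"], intro conjI, simp, rule exI[of _ "1300::real"], intro conjI allI, simp,
    unfold Let_def, intro impI)
  fix n p q :: nat and \<beta> :: "real vec" and \<Theta> :: "real mat" and \<sigma>\<^sub>1 :: real and \<Sigma>\<^sub>2 :: "real mat"
    and P :: "obs measure" and B\<beta> B\<Theta> Bz Bx B\<epsilon>\<^sub>1 B\<epsilon>\<^sub>2 :: real
  define lam where "lam = lambda_min (sigma_z q P)"
  define sig where "sig = sigma_min \<Theta>"
  define K where "K = lam / (6 * Bz\<^sup>2)"
  define K\<^sub>0 where "K\<^sub>0 = lam * sig\<^sup>2 / (2 * B\<epsilon>\<^sub>2\<^sup>2)"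
  define L where "L = ln (K / real q * real n)"
  define dev where "dev = sqrt (2 * real p * (real q + 1) * B\<epsilon>\<^sub>2\<^sup>2 * L / (lam * real n))"
  define x where "x = 1 * Bz\<^sup>2 * (sqrt (real q) + sqrt (L - 1 / 2)) / sqrt (real n)"
  define Cn where "Cn = (B\<Theta> + dev) * Bz / (lam * (1 - x)\<^sup>2 * (sig - dev)\<^sup>2)"
  note defs = lam_def[symmetric] sig_def[symmetric] K_def[symmetric] K\<^sub>0_def[symmetric]
    L_def[symmetric] dev_def[symmetric] x_def[symmetric] Cn_def[symmetric]
  assume model: "linear_model p q \<beta> \<Theta> \<sigma>\<^sub>1 \<Sigma>\<^sub>2 P" and iv: "iv_assumption n p q \<Theta> P"
    and reg: "regularity p q \<beta> \<Theta> P B\<beta> B\<Theta> Bz Bx B\<epsilon>\<^sub>1 B\<epsilon>\<^sub>2"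
    and lam: "0 < lambda_min (sigma_z q P)" and sig: "0 < sigma_min \<Theta>"
    and Bz: "0 < Bz" and B\<epsilon>\<^sub>2: "0 < B\<epsilon>\<^sub>2"
  assume "Max {4 * 1\<^sup>2 * Bz ^ 4 * (real q
          + ln (4 * 1\<^sup>2 * Bz ^ 4 * (lambda_min (sigma_z q P) / (6 * Bz\<^sup>2)) / real q) - 3 / 2),
        real q * exp (3 / 2) / (lambda_min (sigma_z q P) / (6 * Bz\<^sup>2)),
        (real p)\<^sup>2 * (real q + 1)\<^sup>2 * (lambda_min (sigma_z q P) / (6 * Bz\<^sup>2))
          / (real q * (lambda_min (sigma_z q P) * (sigma_min \<Theta>)\<^sup>2 / (2 * B\<epsilon>\<^sub>2\<^sup>2))\<^sup>2)} \<le> real n"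
  then have "4 * Bz ^ 4 * (real q + ln (4 * Bz ^ 4 * K / real q) - 3 / 2) \<le> real n"
    and n2: "real q * exp (3 / 2) / K \<le> real n"
    and n3: "(real p)\<^sup>2 * (real q + 1)\<^sup>2 * K / (real q * K\<^sub>0\<^sup>2) \<le> real n"
    unfolding defs by simp_all
  \<comment> \<open>Brings the first condition into the form with \<open>b = Bz\<^sup>2\<close>,
    which is c Bz^2 for c = 1.\<close>
  moreover have "Bz ^ 4 = (Bz\<^sup>2)\<^sup>2" by simp
  ultimately have n1: "4 * (Bz\<^sup>2)\<^sup>2 * (real q + ln (4 * (Bz\<^sup>2)\<^sup>2 * K / real q) - 3 / 2) \<le> real n"
    by metis
  have p: "0 < p" and pq: "p \<le> q" using iv_assumption_dims[OF iv] by auto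
  then have q: "0 < q" by simp
  have K: "0 < K" using lam Bz by (simp add: K_def lam_def)
  \<comment> \<open>The second condition bounds \<open>n\<close> below by a positive number; this
    excludes the empty sample.\<close>
  have n: "0 < n"
  proof -
    have "0 < real q * exp (3 / 2) / K" using q K by simp
    then show ?thesis using n2 by linarith
  qed
  interpret iv_model n p q \<beta> \<Theta> \<sigma>\<^sub>1 \<Sigma>\<^sub>2 P B\<beta> B\<Theta> Bz Bx B\<epsilon>\<^sub>1 B\<epsilon>\<^sub>2
    using model iv reg lam sig Bz B\<epsilon>\<^sub>2 n by unfold_locales
  have pos: "0 < real n" "1 \<le> real p" "1 \<le> real q" "0 < real p" "0 < real q" "0 < lam" "0 < sig" "0 < Bz\<^sup>2"
    using n p q lam sig Bz by (auto simp: lam_def sig_def)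
  have x_eq: "x = Bz\<^sup>2 * (sqrt (real q) + sqrt (L - 1 / 2)) / sqrt (real n)"
    by (simp add: x_def)
  note x_facts = covariance_deviation_le_one[OF pos(1,3) K pos(8) n1 n2, folded L_def, folded x_eq]
  have x: "0 \<le> x" "x \<le> 1" and x1: "x = 1 \<Longrightarrow> L \<le> 3 / 2"
    by (fact x_facts)+
  have "exp (3 / 2) \<le> K / real q * real n"
    using n2 pos K by (simp add: field_simps)
  then have L: "3 / 2 \<le> L"
    unfolding L_def using pos K by (subst ln_ge_iff) auto
  have dev: "0 \<le> dev" "dev < sig"
  proof -
    show "0 \<le> dev" using L pos by (simp add: dev_def)
    show "dev < sig"
      unfolding dev_def
      using deviation_less[OF pos(1,4,5) K pos(6,7) B\<epsilon>\<^sub>2, folded L_def K\<^sub>0_def] L n3 by simp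
  qed
  have "(LINT \<omega>|sample_law n P. loss \<omega>) \<le> 1300 * (real q / real n) * (B\<beta>\<^sup>2 / K + Cn\<^sup>2 * \<sigma>\<^sub>1\<^sup>2)"
  proof (cases "x < 1")
    case True
    have "(LINT \<omega>|sample_law n P. loss \<omega>)
        \<le> 1300 * (real q / real n) * (B\<beta>\<^sup>2 / K) + 16 * (real q / real n) * (Cn\<^sup>2 * \<sigma>\<^sub>1\<^sup>2)"
    proof (rule order_trans[OF expected_loss_le], rule add_mono)
      show "4 * B\<beta>\<^sup>2 * (4 / (real n)\<^sup>2 * (real n * (Bz\<^sup>2 / lambda_min (sigma_z q P) * real q))
          + 256 / ((real n) ^ 4 * (lambda_min (sigma_z q P))\<^sup>2 * sigma_min \<Theta> ^ 4)
            * (4 * (real n)\<^sup>2 * (B\<epsilon>\<^sub>2\<^sup>2 * real q)\<^sup>2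
              + 3 * real n * (B\<epsilon>\<^sub>2 ^ 4 * (Bz\<^sup>2 / lambda_min (sigma_z q P)) * real q)))
        \<le> 1300 * (real q / real n) * (B\<beta>\<^sup>2 / K)"
        unfolding defs
        by (rule failure_term_le[OF pos(1-3,6,7) Bz B\<epsilon>\<^sub>2 n2[unfolded K_def]
              n3[unfolded K_def K\<^sub>0_def], folded K_def])
      show "16 / ((real n)\<^sup>2 * (lambda_min (sigma_z q P))\<^sup>2 * (sigma_min \<Theta>)\<^sup>2) * (real n * (Bz\<^sup>2 * \<sigma>\<^sub>1\<^sup>2))
        \<le> 16 * (real q / real n) * (Cn\<^sup>2 * \<sigma>\<^sub>1\<^sup>2)"
        unfolding defs unfolding Cn_def
        by (rule noise_term_le[OF pos(1,3,6,7) Bz sigma_min_le_bound[folded sig_def] x(1) True dev])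
    qed
    \<comment> \<open>The failure term dictates the constant; the noise term would be content with
      16.\<close>
    also have "\<dots> \<le> 1300 * (real q / real n) * (B\<beta>\<^sup>2 / K) + 1300 * (real q / real n) * (Cn\<^sup>2 * \<sigma>\<^sub>1\<^sup>2)"
      by (intro add_left_mono mult_right_mono) auto
    finally show ?thesis by (simp only: distrib_left)
  next
    \<comment> \<open>\<open>x = 1\<close> is possible and then \<open>Cn = 0\<close> because of the division by zero; but in this case
      \<open>K n / q = exp (3 / 2)\<close>, so that the bound \<open>4 B\<beta>\<^sup>2\<close> suffices.\<close>
    case False
    then have "L \<le> 3 / 2" using x x1 by linarith
    moreover have "0 < K / real q * real n" using pos K by simp
    ultimately have "K / real q * real n \<le> exp (3 / 2)"
      unfolding L_def by (metis exp_le_cancel_iff exp_ln)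
    then have "K / real q * real n \<le> 9" using exp_three_halves_le by linarith
    then have "1 \<le> 9 * (real q / real n / K)" using pos K by (simp add: field_simps)
    then have "4 * B\<beta>\<^sup>2 * 1 \<le> 4 * B\<beta>\<^sup>2 * (9 * (real q / real n / K))"
      by (rule mult_left_mono) simp
    also have "\<dots> = 36 * (real q / real n) * (B\<beta>\<^sup>2 / K)" by simp
    also have "\<dots> \<le> 1300 * (real q / real n) * (B\<beta>\<^sup>2 / K)"
      using K by (intro mult_right_mono) auto
    also have "\<dots> \<le> 1300 * (real q / real n) * (B\<beta>\<^sup>2 / K + Cn\<^sup>2 * \<sigma>\<^sub>1\<^sup>2)"
      by (intro mult_left_mono) auto
    finally show ?thesis using expected_loss_le_bound by linarith
  qed
  then show "(LINT \<omega>|sample_law n P.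
        (vnorm (clip B\<beta> (beta_2sls (data_Z n q \<omega>) (data_X n p q \<Theta> \<omega>) (data_Y n p q \<beta> \<Theta> \<omega>))
          - \<beta>))\<^sup>2)
      \<le> 1300 * (real q / real n) * (B\<beta>\<^sup>2 / (lambda_min (sigma_z q P) / (6 * Bz\<^sup>2))
        + ((B\<Theta> + sqrt (2 * real p * (real q + 1) * B\<epsilon>\<^sub>2\<^sup>2
              * ln (lambda_min (sigma_z q P) / (6 * Bz\<^sup>2) / real q * real n)
              / (lambda_min (sigma_z q P) * real n))) * Bz
           / (lambda_min (sigma_z q P)
              * (1 - 1 * Bz\<^sup>2 * (sqrt (real q)
                  + sqrt (ln (lambda_min (sigma_z q P) / (6 * Bz\<^sup>2) / real q * real n) - 1 / 2))
                / sqrt (real n))\<^sup>2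
              * (sigma_min \<Theta> - sqrt (2 * real p * (real q + 1) * B\<epsilon>\<^sub>2\<^sup>2
                  * ln (lambda_min (sigma_z q P) / (6 * Bz\<^sup>2) / real q * real n)
                  / (lambda_min (sigma_z q P) * real n)))\<^sup>2))\<^sup>2 * \<sigma>\<^sub>1\<^sup>2)"
    unfolding loss_def defs .
qed

end
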